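(* Let $0<p<q<\infty$. (i) There is a constant $C$ with $\sqrt{\frac{q}{p}}\le C\le \sqrt{\frac{q}{\min\{p,2\}}}$ such that for each $n\in\mathbb{N}$ and every polynomial $P\in\mathcal{P}(\mathbb{C}^n)$ we have $$\|P\|_{L^q(\mathbb{T}^n)}\le C^{\deg(P)}\,\|P\|_{L^p(\mathbb{T}^n)}.$$ (ii) The best possible (i.e. smallest) constant $C=C(p,q)$ such that $$\|P\|_{L^q(\mathbb{T}^n)}\le C^{\deg(P)}\,\|P\|_{L^p(\mathbb{T}^n)}$$ holds for all $n\in\mathbb{N}$ and all homogeneous polynomials $P\in\mathcal{P}(\mathbb{C}^n)$ equals $\sqrt{\frac{q}{p}}$.
   Context: $\mathcal{P}(\mathbb{C}^n)$ is the space of all polynomials $P(z)=\sum_\alpha c_\alpha(P)z^\alpha$ on $\mathbb{C}^n$ (finite sum over multi-indices $\alpha\in\mathbb{N}_0^n$, $z^\alpha=z_1^{\alpha_1}\cdots z_n^{\alpha_n}$, $|\alpha|=\sum_j\alpha_j$). The total degree is $\deg(P)=\max\{|\alpha| : c_\alpha(P)\ne 0\}$ (read as $0$ for the zero polynomial). If $m=\deg(P)$ and $c_\alpha(P)=0$ for all $|\alpha|<m$, then $P$ is called $m$-homogeneous; $P$ is homogeneous if it is $m$-homogeneous for some $m$. $\mathbb{T}^n=\{z\in\mathbb{C}^n : |z_1|=\dots=|z_n|=1\}$ is equipped with the normalized Lebesgue (Haar probability) measure $dz$, and for $0<p<\infty$, $\|P\|_{L^p(\mathbb{T}^n)}=\big(\int_{\mathbb{T}^n}|P(z)|^p\,dz\big)^{1/p}$.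 The constant $C$ does not depend on $n$ or $P$. *)

theory Defs
  imports "HOL-Analysis.Analysis" "HOL-Library.Poly_Mapping"
begin

text \<open>
  Since the dimension \<open>n\<close> is quantified inside the theorem, points of $\mathbb{C}^n$ are functions
  \<open>z :: nat \<Rightarrow> complex\<close> of which only the values at \<open>i < n\<close> matter, multi-indices are finitely
  supported functions \<open>\<alpha> :: nat \<Rightarrow>\<^sub>0 nat\<close>, and a polynomial is the finitely supported family of its
  coefficients \<open>c\<^sub>\<alpha>(P) = lookup P \<alpha>\<close>.
\<close>

type_synonym cpoly = "(nat \<Rightarrow>\<^sub>0 nat) \<Rightarrow>\<^sub>0 complex"

definition polys :: "nat \<Rightarrow> cpoly set" where
  "polys n = {P. \<forall>\<alpha>\<in>Poly_Mapping.keys P. Poly_Mapping.keys \<alpha> \<subseteq> {..<n}}"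

definition mdeg :: "(nat \<Rightarrow>\<^sub>0 nat) \<Rightarrow> nat" where
  "mdeg \<alpha> = (\<Sum>i\<in>Poly_Mapping.keys \<alpha>. Poly_Mapping.lookup \<alpha> i)"

definition monomial_eval :: "(nat \<Rightarrow>\<^sub>0 nat) \<Rightarrow> (nat \<Rightarrow> complex) \<Rightarrow> complex" where
  "monomial_eval \<alpha> z = (\<Prod>i\<in>Poly_Mapping.keys \<alpha>. z i ^ Poly_Mapping.lookup \<alpha> i)"

definition poly_eval :: "cpoly \<Rightarrow> (nat \<Rightarrow> complex) \<Rightarrow> complex" where
  "poly_eval P z = (\<Sum>\<alpha>\<in>Poly_Mapping.keys P. Poly_Mapping.lookup P \<alpha> * monomial_eval \<alpha> z)"

text \<open>Inserting \<open>0\<close> only matters for the zero polynomial, which thereby gets degree \<open>0\<close>.\<close>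

definition total_deg :: "cpoly \<Rightarrow> nat" where
  "total_deg P = Max (insert 0 (mdeg ` Poly_Mapping.keys P))"

definition m_homogeneous :: "nat \<Rightarrow> cpoly \<Rightarrow> bool" where
  "m_homogeneous m P \<longleftrightarrow>
     total_deg P = m \<and> (\<forall>\<alpha>. mdeg \<alpha> < m \<longrightarrow> Poly_Mapping.lookup P \<alpha> = 0)"

definition homogeneous :: "cpoly \<Rightarrow> bool" where
  "homogeneous P \<longleftrightarrow> (\<exists>m. m_homogeneous m P)"

text \<open>
  The normalized Lebesgue measure on the unit circle is the image under \<open>t \<mapsto> e\<^sup>i\<^sup>t\<close> of the uniform
  distribution on \<open>[0, 2\<pi>)\<close>; the one on the torus is its \<open>n\<close>-fold product, whose underlying space
  consists of the functions from \<open>{..<n}\<close> to the unit circle (\<open>undefined\<close> outside \<open>{..<n}\<close>).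
\<close>

definition circle_measure :: "complex measure" where
  "circle_measure =
     distr (uniform_measure lborel {0..<2 * pi}) (restrict_space borel (sphere 0 1)) cis"

definition torus_measure :: "nat \<Rightarrow> (nat \<Rightarrow> complex) measure" where
  "torus_measure n = Pi\<^sub>M {..<n} (\<lambda>_. circle_measure)"

definition Lp_norm :: "real \<Rightarrow> nat \<Rightarrow> cpoly \<Rightarrow> real" where
  "Lp_norm p n P =
     (\<integral>z. norm (poly_eval P z) powr p \<partial>torus_measure n) powr (1 / p)"

end

(*
  Homogenizing P with one more variable w, as w^m P(z/w), leaves all norms unchanged, so it suffices
  that F(z) -> F(r z), with r^2 = p/q, is a contraction from L^p to L^q for polynomials F. Minkowski's
  inequality reduces this to one variable. There zeros are reflected out of the disc, so F = exp h, and
  the norm of exp (h (sqrt (p/s) z)) in L^s is decreasing in s because of the logarithmic Sobolev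
  inequality Ent(|G|^2) <= sum n |G_n|^2 for analytic G = K^2. The latter combines
  Ent(v^2) <= 2 sum |n| |v_n|^2 for v = |K|^2 (Weissler; third order Taylor expansion of v^2 ln v^2 at
  the L^2 norm of v) with 4 sum_{n>0} n |v_n|^2 <= sum n |G_n|^2, a positive definiteness statement.

  The constant is optimal for (z_1 + ... + z_n)^m: as n tends to infinity, the even moments of
  (z_1 + ... + z_n) / sqrt n tend to those k! of a complex Gaussian, and (k!)^(1/k) ~ k/e.
*)
theory Submission
  imports Defs "HOL-Complex_Analysis.Complex_Analysis" "HOL-Probability.Infinite_Product_Measure"
    "HOL-Real_Asymp.Real_Asymp" "HOL-Computational_Algebra.Fundamental_Theorem_Algebra"
begin

section \<open>The circle\<close>

text \<open>Zeros are the obstacle. For a zero-free \<open>exp h\<close> every power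
  \<open>|exp h|^s\<close> is the squared modulus of the analytic function
  \<open>exp (s h / 2)\<close>, so a single logarithmic Sobolev inequality at exponent 2 serves all
  exponents \<open>s > 0\<close>, including those below 1. Reflecting zeros is harmless because the
  contracted side is evaluated in the disc, where moduli only grow, while the other side lives on
  the circle, where they do not change. The two halves of that inequality fit together because
  \<open>v\<close> is real: its frequencies \<open>n\<close> and \<open>-n\<close> contribute
  equally, so \<open>2 sum |n| |v_n|^2\<close> is \<open>4 sum_{n>0} n |v_n|^2\<close>. A
  contraction by \<open>r\<close> acts on a homogeneous polynomial of degree \<open>m\<close> as
  multiplication by \<open>r^m\<close>. This is where the power \<open>deg P\<close> of the constant
  comes from, and since homogenization keeps the norms, the same constant serves all
  polynomials.\<close>

lemma space_circle_measure [simp]: "space circle_measure = sphere 0 1"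
  by (simp add: circle_measure_def space_restrict_space)

lemma sets_circle_measure [measurable_cong]:
  "sets circle_measure = sets (restrict_space borel (sphere 0 1))"
  by (simp add: circle_measure_def)

lemma measurable_cis_sphere [measurable]:
  "cis \<in> borel \<rightarrow>\<^sub>M restrict_space borel (sphere 0 1)"
  by (intro measurable_restrict_space2 borel_measurable_continuous_onI continuous_intros) auto

lemma prob_space_circle_measure: "prob_space circle_measure"
  unfolding circle_measure_def
proof (rule prob_space.prob_space_distr)
  show "prob_space (uniform_measure lborel {0..<2 * pi})"
    by (rule prob_space_uniform_measure) auto
qed (simp add: measurable_def, use measurable_cis_sphere in \<open>simp add: measurable_def\<close>)

interpretation circle: prob_space circle_measure
  by (rule prob_space_circle_measure)

lemma measure_circle_sphere [simp]: "measure circle_measure (sphere 0 1) = 1"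
  using circle.prob_space by simp

lemma measurable_circle_continuous:
  fixes f :: "complex \<Rightarrow> 'a::{banach, second_countable_topology}"
  assumes "continuous_on (sphere 0 1) f"
  shows "f \<in> borel_measurable circle_measure"
  using borel_measurable_continuous_on_restrict[OF assms]
  by (simp add: measurable_cong_sets[OF sets_circle_measure refl])

lemma integrable_circle_continuous:
  fixes f :: "complex \<Rightarrow> 'a::{banach, second_countable_topology}"
  assumes "continuous_on (sphere 0 1) f"
  shows "integrable circle_measure f"
proof -
  have "bounded (f ` sphere 0 1)"
    using assms compact_continuous_image compact_imp_bounded compact_sphere by blast
  then obtain B where "\<And>z. z \<in> sphere 0 1 \<Longrightarrow> norm (f z) \<le> B"
    unfolding bounded_iff by blast
  then show ?thesis
    by (intro circle.integrable_const_bound[where B=B] AE_I2 measurable_circle_continuous assms) simp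
qed

text \<open>The endpoint \<open>2 * pi\<close> is a null set. The closed interval gives access to
  the Henstock-Kurzweil integral, in which shifts and differentiation under the integral sign are
  carried out.\<close>

lemma circle_integral_eq:
  fixes f :: "complex \<Rightarrow> 'a::euclidean_space"
  assumes "continuous_on (sphere 0 1) f"
  shows "integral\<^sup>L circle_measure f = (1 / (2 * pi)) *\<^sub>R integral {0..2 * pi} (\<lambda>t. f (cis t))"
proof -
  have fb: "f \<in> borel_measurable (restrict_space borel (sphere 0 1))"
    using borel_measurable_continuous_on_restrict[OF assms] .
  have cont: "continuous_on UNIV (\<lambda>t. f (cis t))"
    by (rule continuous_on_compose2[OF assms]) (auto intro!: continuous_intros)
  then have meas [measurable]: "(\<lambda>t. f (cis t)) \<in> borel_measurable borel"
    by (rule borel_measurable_continuous_onI)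
  have u: "uniform_measure lborel {0..<2 * pi} =
      density lborel (\<lambda>t. ennreal (indicator {0..<2 * pi} t / (2 * pi)))"
    unfolding uniform_measure_def
    by (rule arg_cong[where f="density lborel"])
       (auto simp: fun_eq_iff indicator_def divide_ennreal[symmetric] ennreal_1[symmetric] simp del: ennreal_1)
  have "integral\<^sup>L circle_measure f = (\<integral>t. f (cis t) \<partial>uniform_measure lborel {0..<2 * pi})"
    unfolding circle_measure_def
    by (rule integral_distr[OF _ fb]) (use measurable_cis_sphere in \<open>simp add: measurable_def\<close>)
  also have "\<dots> = (\<integral>t. (indicator {0..<2 * pi} t / (2 * pi)) *\<^sub>R f (cis t) \<partial>lborel)"
    unfolding u by (subst integral_density) (auto simp: indicator_def)
  also have "\<dots> = (\<integral>t. (1 / (2 * pi)) *\<^sub>R (indicator {0..<2 * pi} t *\<^sub>R f (cis t)) \<partial>lborel)"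
    by (intro Bochner_Integration.integral_cong) auto
  also have "\<dots> = (1 / (2 * pi)) *\<^sub>R (\<integral>t. indicator {0..<2 * pi} t *\<^sub>R f (cis t) \<partial>lborel)"
    by (rule Bochner_Integration.integral_scaleR_right)
  also have "(\<integral>t. indicator {0..<2 * pi} t *\<^sub>R f (cis t) \<partial>lborel)
      = (\<integral>t. indicator {0..2 * pi} t *\<^sub>R f (cis t) \<partial>lborel)"
  proof (rule integral_cong_AE)
    have "AE t in lborel. t \<noteq> 2 * pi"
      by (rule AE_lborel_singleton)
    then show "AE t in lborel. indicator {0..<2 * pi} t *\<^sub>R f (cis t)
        = indicator {0..2 * pi} t *\<^sub>R f (cis t)"
      by eventually_elim (auto simp: indicator_def)
  qed auto
  also have "\<dots> = integral {0..2 * pi} (\<lambda>t. f (cis t))"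
  proof -
    have "set_integrable lborel {0..2 * pi} (\<lambda>t. f (cis t))"
      by (rule borel_integrable_compact[of "{0..2*pi}" "\<lambda>t. f (cis t)", folded set_integrable_def])
         (auto intro: continuous_on_subset[OF cont])
    from set_borel_integral_eq_integral(2)[OF this] show ?thesis
      by (simp add: set_lebesgue_integral_def)
  qed
  finally show ?thesis .
qed

lemma circle_integral_rotate:
  fixes f :: "complex \<Rightarrow> 'a::euclidean_space"
  assumes f: "continuous_on (sphere 0 1) f" and w: "norm w = 1"
  shows "(\<integral>z. f (w * z) \<partial>circle_measure) = integral\<^sup>L circle_measure f"
proof -
  obtain s where s: "0 \<le> s" "s < 2 * pi" "w = cis s"
    by (metis Arg2pi_eq Arg2pi_ge_0 Arg2pi_lt_2pi cis_conv_exp mult_1 of_real_1 w)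
  define g where "g t = f (cis t)" for t
  have cont: "continuous_on A g" for A
    unfolding g_def by (rule continuous_on_compose2[OF f]) (auto intro!: continuous_intros)
  have int: "g integrable_on {a..b}" for a b
    using cont integrable_continuous_real by blast
  have per: "g (t + 2 * pi) = g t" for t
    by (simp add: g_def cis_mult[symmetric])
  have shift: "integral {a..b} (\<lambda>t. g (t + c)) = integral {a + c..b + c} g" for a b c
    using integral_shift_Icc_real[of a b g c] by (simp add: comp_def add.commute)
  have "continuous_on (sphere 0 1) (\<lambda>z. f (w * z))"
    by (rule continuous_on_compose2[OF f]) (auto intro!: continuous_intros simp: norm_mult w)
  then have "(\<integral>z. f (w * z) \<partial>circle_measure)
      = (1 / (2 * pi)) *\<^sub>R integral {0..2 * pi} (\<lambda>t. g (t + s))"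
    by (simp add: circle_integral_eq s(3) cis_mult g_def add.commute)
  also have "integral {0..2 * pi} (\<lambda>t. g (t + s)) = integral {s..2 * pi + s} g"
    using shift[of 0 "2*pi" s] by simp
  \<comment> \<open>The shifted period is cut at \<open>2 * pi\<close>; the overhang is moved back
    to \<open>{0..s}\<close> by periodicity.\<close>
  also have "\<dots> = integral {s..2 * pi} g + integral {2 * pi..2 * pi + s} g"
    using s by (subst Henstock_Kurzweil_Integration.integral_combine[symmetric, where c="2*pi"]) (auto intro: int)
  also have "integral {2 * pi..2 * pi + s} g = integral {0..s} g"
    using shift[of 0 s "2*pi"] by (simp add: per add.commute)
  also have "integral {s..2 * pi} g + integral {0..s} g = integral {0..2 * pi} g"
    using s by (subst add.commute, subst Henstock_Kurzweil_Integration.integral_combine) (auto intro: int)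
  finally show ?thesis
    using circle_integral_eq[OF f] by (simp add: g_def[abs_def])
qed

lemma circle_integral_power:
  assumes "n > 0"
  shows "(\<integral>z. z ^ n \<partial>circle_measure) = 0"
proof -
  \<comment> \<open>The rotation is chosen with \<open>w ^ n = -1\<close>, so by invariance the
    integral equals its own negative.\<close>
  define w where "w = cis (pi / n)"
  have w: "norm w = 1" "w ^ n = -1"
    using assms by (simp_all add: w_def Complex.DeMoivre)
  have "(\<integral>z. (w * z) ^ n \<partial>circle_measure) = (\<integral>z. z ^ n \<partial>circle_measure)"
    by (rule circle_integral_rotate[OF _ w(1)]) (intro continuous_intros)
  then show ?thesis
    by (simp add: power_mult_distrib w(2))
qed

lemma circle_integral_monomials:
  "(\<integral>z. z ^ j * cnj (z ^ k) \<partial>circle_measure) = (if j = k then 1 else 0)"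
proof -
  have *: "z ^ j * cnj (z ^ k) = z ^ (j - k)" if "k \<le> j" "z \<in> sphere 0 1" for z :: complex and j k
  proof -
    have "z ^ j * cnj (z ^ k) = z ^ (j - k) * (z * cnj z) ^ k"
      using that by (simp add: power_mult_distrib flip: power_add mult.assoc)
    also have "z * cnj z = 1"
      using that by (simp add: complex_norm_square[symmetric])
    finally show ?thesis by simp
  qed
  have le: "(\<integral>z. z ^ j * cnj (z ^ k) \<partial>circle_measure) = (if j = k then 1 else 0)" if "k \<le> j" for j k
  proof -
    have "(\<integral>z. z ^ j * cnj (z ^ k) \<partial>circle_measure) = (\<integral>z. z ^ (j - k) \<partial>circle_measure)"
      using * that by (intro Bochner_Integration.integral_cong) auto
    also have "\<dots> = (if j = k then 1 else 0)"
      using that circle_integral_power[of "j - k"] circle.prob_space by auto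
    finally show ?thesis .
  qed
  show ?thesis
  proof (cases "k \<le> j")
    case True
    then show ?thesis by (rule le)
  next
    case False
    have "(\<integral>z. z ^ j * cnj (z ^ k) \<partial>circle_measure) = (\<integral>z. cnj (z ^ k * cnj (z ^ j)) \<partial>circle_measure)"
      by (simp add: mult.commute)
    also have "\<dots> = cnj (\<integral>z. z ^ k * cnj (z ^ j) \<partial>circle_measure)"
      by (rule Bochner_Integration.integral_cnj)
    finally show ?thesis
      using le[of j k] False by simp
  qed
qed

section \<open>A logarithmic Sobolev inequality for trigonometric polynomials\<close>

text \<open>Parseval. The common bound \<open>N\<close> allows pairing polynomials of different
  degrees, such as \<open>A\<^sup>2\<close> with \<open>A\<close>.\<close>

lemma circle_integral_poly_cnj:
  assumes "degree p \<le> N" "degree q \<le> N"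
  shows "(\<integral>z. poly p z * cnj (poly q z) \<partial>circle_measure) = (\<Sum>n\<le>N. coeff p n * cnj (coeff q n))"
proof -
  have *: "poly p z = (\<Sum>n\<le>N. coeff p n * z ^ n)" if "degree p \<le> N" for p :: "complex poly" and z
    unfolding poly_altdef using that by (intro sum.mono_neutral_left) (auto simp: coeff_eq_0)
  have int: "integrable circle_measure (\<lambda>z. z ^ j * cnj (z ^ k))" for j k
    by (intro integrable_circle_continuous continuous_intros)
  have "(\<integral>z. poly p z * cnj (poly q z) \<partial>circle_measure)
      = (\<integral>z. (\<Sum>j\<le>N. \<Sum>k\<le>N. (coeff p j * cnj (coeff q k)) * (z ^ j * cnj (z ^ k))) \<partial>circle_measure)"
    by (simp add: *[OF assms(1)] *[OF assms(2)] sum_product mult_ac)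
  also have "\<dots> = (\<Sum>j\<le>N. \<Sum>k\<le>N. (coeff p j * cnj (coeff q k)) * (if j = k then 1 else 0))"
    using int by (simp add: Bochner_Integration.integral_sum integrable_sum circle_integral_monomials
        del: complex_cnj_power complex_cnj_mult)
  also have "\<dots> = (\<Sum>n\<le>N. coeff p n * cnj (coeff q n))"
    by (simp add: if_distrib cong: if_cong)
  finally show ?thesis .
qed

lemma circle_integral_poly: "(\<integral>z. poly p z \<partial>circle_measure) = coeff p 0"
proof -
  have "(\<integral>z. poly p z * cnj (poly 1 z) \<partial>circle_measure)
      = (\<Sum>n\<le>degree p. coeff p n * cnj (coeff 1 n))"
    by (rule circle_integral_poly_cnj) auto
  also have "\<dots> = (\<Sum>n\<le>degree p. if n = 0 then coeff p 0 else 0)"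
    by (intro sum.cong) (auto simp: coeff_1)
  finally show ?thesis by simp
qed

text \<open>Only zeros of \<open>f\<close> need care: \<open>x * ln x\<close> tends to 0 there, and
  its value at 0 is 0 whatever \<open>ln 0\<close> is. The entropy integrands do have zeros.\<close>

lemma continuous_on_x_ln:
  fixes f :: "'a::topological_space \<Rightarrow> real"
  assumes "continuous_on X f" "\<And>x. x \<in> X \<Longrightarrow> 0 \<le> f x"
  shows "continuous_on X (\<lambda>x. f x * ln (f x))"
proof -
  have "continuous (at x within {0..}) (\<lambda>x::real. x * ln x)" if "0 \<le> x" for x
  proof (cases "x = 0")
    case True
    have "((\<lambda>x::real. x * ln x) \<longlongrightarrow> 0) (at_right 0)"
      by real_asymp
    then show ?thesis
      using True by (simp add: continuous_within at_within_Ici_at_right)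
  next
    case False
    then show ?thesis using that by (intro continuous_intros) auto
  qed
  then have "continuous_on {0..} (\<lambda>x::real. x * ln x)"
    by (simp add: continuous_on_eq_continuous_within)
  then show ?thesis
    by (rule continuous_on_compose2) (use assms in auto)
qed

text \<open>The right side is the Taylor polynomial of degree 3 at 1; the fourth derivative
  \<open>- 4 / v\<^sup>2\<close> of the left side is negative.\<close>

lemma sq_ln_sq_le:
  fixes v :: real
  assumes "0 \<le> v"
  shows "v\<^sup>2 * ln (v\<^sup>2) \<le> 2 * (v - 1) + 3 * (v - 1)\<^sup>2 + 2 / 3 * (v - 1) ^ 3"
proof (cases "v = 0")
  case False
  with assms have v: "v > 0" by simp
  \<comment> \<open>The difference \<phi> of the two sides has derivative
    \<open>2 * v * \<psi> v\<close>. As \<psi> increases and vanishes at 1, \<phi> attains its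
    minimum 0 there.\<close>
  define \<psi> where "\<psi> v = v - 1 / v - 2 * ln v" for v :: real
  have d\<psi>: "(\<psi> has_real_derivative (1 - 1 / v)\<^sup>2) (at v)" if "v > 0" for v
    unfolding \<psi>_def using that
    by (auto intro!: derivative_eq_intros simp: field_simps power2_eq_square)
  have \<psi>_mono: "\<psi> a \<le> \<psi> b" if "0 < a" "a \<le> b" for a b
    using that(2)
  proof (rule DERIV_nonneg_imp_nondecreasing)
    fix x assume "a \<le> x" "x \<le> b"
    then show "\<exists>y. (\<psi> has_real_derivative y) (at x) \<and> 0 \<le> y"
      using d\<psi>[of x] that by (intro exI[of _ "(1 - 1 / x)\<^sup>2"]) auto
  qed
  have \<psi>1: "\<psi> 1 = 0" by (simp add: \<psi>_def)
  define \<phi> where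
    "\<phi> v = 2 * (v - 1) + 3 * (v - 1)\<^sup>2 + 2 / 3 * (v - 1) ^ 3 - 2 * v\<^sup>2 * ln v" for v :: real
  have d\<phi>: "(\<phi> has_real_derivative 2 * v * \<psi> v) (at v)" if "v > 0" for v
    unfolding \<phi>_def \<psi>_def using that
    by (auto intro!: derivative_eq_intros simp: field_simps power2_eq_square power3_eq_cube)
  have "\<phi> 1 \<le> \<phi> v"
  proof (cases "1 \<le> v")
    case True
    then show ?thesis
    proof (rule DERIV_nonneg_imp_nondecreasing)
      fix x assume "1 \<le> x" "x \<le> v"
      then show "\<exists>y. (\<phi> has_real_derivative y) (at x) \<and> 0 \<le> y"
        using \<psi>_mono[of 1 x] \<psi>1 d\<phi>[of x] by (intro exI[of _ "2 * x * \<psi> x"]) auto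
    qed
  next
    case False
    then have "v \<le> 1" by simp
    then show ?thesis
    proof (rule DERIV_nonpos_imp_nonincreasing)
      fix x assume "v \<le> x" "x \<le> 1"
      then show "\<exists>y. (\<phi> has_real_derivative y) (at x) \<and> y \<le> 0"
        using \<psi>_mono[of x 1] \<psi>1 d\<phi>[of x] v
        by (intro exI[of _ "2 * x * \<psi> x"]) (auto intro: mult_nonneg_nonpos)
    qed
  qed
  then show ?thesis
    using v by (simp add: \<phi>_def ln_realpow)
qed simp

text \<open>A resonance \<open>n = j + k\<close> of positive frequencies has \<open>n \<ge> 2\<close>, so the
  surplus \<open>(n - 1) |A\<^sub>n|\<^sup>2\<close> of the Dirichlet form over the \<open>L\<^sup>2\<close> norm absorbs the cubic term.\<close>
lemma cubic_term_le:
  fixes A :: "complex poly"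
  assumes A0: "coeff A 0 = 0"
  shows "1 / 2 * Re (\<Sum>n\<le>M. coeff (A\<^sup>2) n * cnj (coeff A n))
    \<le> (\<Sum>n\<le>M. (real n - 1) * (norm (coeff A n))\<^sup>2) + 1 / 16 * (\<Sum>n\<le>M. (norm (coeff A n))\<^sup>2)\<^sup>2"
proof -
  define a where "a n = (norm (coeff A n))\<^sup>2" for n
  have a0: "a 0 = 0" and a_nn: "\<And>n. 0 \<le> a n" by (simp_all add: a_def A0)
  have le: "1 / 2 * Re (coeff (A\<^sup>2) n * cnj (coeff A n))
      \<le> (real n - 1) * a n + 1 / 16 * (\<Sum>j\<le>n. a j * a (n - j))" for n
  proof (cases "n \<ge> 2")
    case False
    then have "n = 0 \<or> n = 1" by auto
    then show ?thesis
      by (auto simp: coeff_mult power2_eq_square A0 a0)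
  next
    case True
    define k where "k = real n - 1"
    have k: "k > 0" using True by (simp add: k_def)
    define D where "D = (\<Sum>j\<le>n. a j * a (n - j))"
    define b where "b = norm (coeff (A\<^sup>2) n)"
    define c where "c = norm (coeff A n)"
    have ends: "{..n} - {1..<n} = {0, n}" using True by auto
    have "coeff (A\<^sup>2) n = (\<Sum>j\<le>n. coeff A j * coeff A (n - j))"
      by (simp add: power2_eq_square coeff_mult)
    also have "\<dots> = (\<Sum>j\<in>{1..<n}. coeff A j * coeff A (n - j))"
      by (rule sum.mono_neutral_right) (simp_all only: ends, auto simp: A0)
    finally have "b \<le> (\<Sum>j\<in>{1..<n}. norm (coeff A j * coeff A (n - j)))"
      unfolding b_def by (simp add: sum_norm_le)
    then have "b\<^sup>2 \<le> (\<Sum>j\<in>{1..<n}. norm (coeff A j * coeff A (n - j)))\<^sup>2"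
      by (intro power_mono) (simp_all add: b_def)
    \<comment> \<open>Cauchy-Schwarz costs the number \<open>n - 1\<close> of pairs, which is
      exactly the weight of the surplus, so a constant independent of \<open>n\<close>
      remains.\<close>
    also have "\<dots> \<le> real (card {1..<n}) * (\<Sum>j\<in>{1..<n}. (norm (coeff A j * coeff A (n - j)))\<^sup>2)"
      using sum_squared_le_sum_of_squares[of "\<lambda>j. norm (coeff A j * coeff A (n - j))" "{1..<n}"]
      by (simp add: mult.commute)
    also have "(\<Sum>j\<in>{1..<n}. (norm (coeff A j * coeff A (n - j)))\<^sup>2) = D"
      unfolding D_def
      by (rule sum.mono_neutral_cong_left)
         (simp_all only: ends, auto simp: a_def norm_mult power_mult_distrib A0)
    also have "real (card {1..<n}) = k" using True by (simp add: k_def)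
    finally have bD: "b\<^sup>2 \<le> k * D" .
    \<comment> \<open>Arithmetic-geometric mean, balanced so that \<open>b * c / 2\<close> uses up
      the whole surplus \<open>k * c\<^sup>2\<close>; this leaves the constant \<open>1 / 16\<close>
      in front of \<open>D\<close>.\<close>
    have "0 \<le> (4 * k * c - b)\<^sup>2" by simp
    then have "8 * k * (b * c) \<le> 16 * k * k * c\<^sup>2 + b\<^sup>2"
      by (simp add: power2_eq_square algebra_simps)
    with bD have "8 * k * (b * c) \<le> 8 * k * (2 * k * c\<^sup>2 + D / 8)"
      by (simp add: algebra_simps)
    then have "b * c \<le> 2 * k * c\<^sup>2 + D / 8"
      using k by simp
    moreover have "Re (coeff (A\<^sup>2) n * cnj (coeff A n)) \<le> b * c"
      using complex_Re_le_cmod[of "coeff (A\<^sup>2) n * cnj (coeff A n)"]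
      by (simp only: b_def c_def norm_mult complex_mod_cnj)
    ultimately have "1 / 2 * Re (coeff (A\<^sup>2) n * cnj (coeff A n)) \<le> k * c\<^sup>2 + 1 / 16 * D"
      by linarith
    then show ?thesis
      by (simp only: k_def D_def a_def c_def)
  qed
  have "1 / 2 * Re (\<Sum>n\<le>M. coeff (A\<^sup>2) n * cnj (coeff A n))
      \<le> (\<Sum>n\<le>M. (real n - 1) * a n + 1 / 16 * (\<Sum>j\<le>n. a j * a (n - j)))"
    unfolding Re_sum by (subst sum_distrib_left) (intro sum_mono le)
  also have "\<dots> = (\<Sum>n\<le>M. (real n - 1) * a n) + 1 / 16 * (\<Sum>n\<le>M. \<Sum>j\<le>n. a j * a (n - j))"
    by (simp add: sum.distrib sum_distrib_left)
  also have "(\<Sum>n\<le>M. \<Sum>j\<le>n. a j * a (n - j)) = (\<Sum>(i, j)\<in>{(i, j). i + j \<le> M}. a i * a j)"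
    by (simp add: sum.triangle_reindex_eq)
  also have "\<dots> \<le> (\<Sum>(i, j)\<in>{..M} \<times> {..M}. a i * a j)"
    by (rule sum_mono2) (auto simp: a_nn)
  also have "\<dots> = (\<Sum>n\<le>M. a n)\<^sup>2"
    by (simp add: power2_eq_square sum_product sum.cartesian_product)
  finally show ?thesis by (simp add: a_def)
qed

text \<open>Here and in the cubic analogue the analytic power integrates to its constant
  coefficient, which is 0 for \<open>a = poly A z\<close> with \<open>coeff A 0 = 0\<close>; only
  the mixed term survives.\<close>

lemma Re_power2_eq: "(Re a)\<^sup>2 = Re (1 / 2 * (a * cnj a) + 1 / 2 * a\<^sup>2)"
  by (simp add: power2_eq_square field_simps)

lemma Re_power3_eq: "(Re a) ^ 3 = Re (3 / 4 * (a\<^sup>2 * cnj a) + 1 / 4 * a ^ 3)"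
  by (simp add: power2_eq_square power3_eq_cube field_simps)

text \<open>After the Taylor bound only the moments of \<open>g = Re A\<close> up to order three
  enter: the first is 0, the second is fixed by the normalization, and the third is controlled by
  \<open>cubic_term_le\<close>.\<close>

lemma log_sobolev_trig_normalized:
  fixes A :: "complex poly" and \<alpha> :: real
  defines "v \<equiv> \<lambda>z. \<alpha> + Re (poly A z)"
  assumes A0: "coeff A 0 = 0" and nn: "\<And>z. norm z = 1 \<Longrightarrow> 0 \<le> v z"
    and norm: "(\<integral>z. (v z)\<^sup>2 \<partial>circle_measure) = 1"
  shows "(\<integral>z. (v z)\<^sup>2 * ln ((v z)\<^sup>2) \<partial>circle_measure)
    \<le> (\<Sum>n\<le>degree A. real n * (norm (coeff A n))\<^sup>2)"
proof -
  define M where "M = 3 * degree A"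
  define g where "g z = Re (poly A z)" for z
  define S where "S = (\<Sum>n\<le>M. (norm (coeff A n))\<^sup>2)"
  define T where "T = Re (\<Sum>n\<le>M. coeff (A\<^sup>2) n * cnj (coeff A n))"
  have cont [continuous_intros]: "continuous_on X g" for X
    unfolding g_def by (intro continuous_intros)
  note int = integrable_circle_continuous
  have deg: "degree A \<le> M" "degree (A\<^sup>2) \<le> M"
    using degree_power_le[of A 2] by (auto simp: M_def)
  have int1: "(\<integral>z. g z \<partial>circle_measure) = 0"
    unfolding g_def
    by (subst integral_Re) (auto intro!: int continuous_intros simp: circle_integral_poly A0)
  have int2: "(\<integral>z. (g z)\<^sup>2 \<partial>circle_measure) = S / 2"
  proof -
    have "(g z)\<^sup>2 = Re (1 / 2 * (poly A z * cnj (poly A z)) + 1 / 2 * poly (A\<^sup>2) z)" for z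
      by (simp only: g_def Re_power2_eq poly_power)
    then have "(\<integral>z. (g z)\<^sup>2 \<partial>circle_measure)
        = Re (\<integral>z. 1 / 2 * (poly A z * cnj (poly A z)) + 1 / 2 * poly (A\<^sup>2) z \<partial>circle_measure)"
      by (simp only:) (intro integral_Re int continuous_intros)
    also have "(\<integral>z. 1 / 2 * (poly A z * cnj (poly A z)) + 1 / 2 * poly (A\<^sup>2) z \<partial>circle_measure)
        = 1 / 2 * (\<Sum>n\<le>M. coeff A n * cnj (coeff A n)) + 1 / 2 * coeff (A\<^sup>2) 0"
      by (subst Bochner_Integration.integral_add)
         (auto intro!: int continuous_intros
           simp del: poly_power simp add: circle_integral_poly circle_integral_poly_cnj[OF deg(1) deg(1)])
    also have "Re \<dots> = S / 2"
      unfolding S_def cmod_power2 by (simp add: A0 coeff_mult power2_eq_square)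
    finally show ?thesis .
  qed
  have int3: "(\<integral>z. (g z) ^ 3 \<partial>circle_measure) = 3 / 4 * T"
  proof -
    have "(g z) ^ 3 = Re (3 / 4 * (poly (A\<^sup>2) z * cnj (poly A z)) + 1 / 4 * poly (A ^ 3) z)" for z
      by (simp only: g_def Re_power3_eq poly_power)
    then have "(\<integral>z. (g z) ^ 3 \<partial>circle_measure)
        = Re (\<integral>z. 3 / 4 * (poly (A\<^sup>2) z * cnj (poly A z)) + 1 / 4 * poly (A ^ 3) z \<partial>circle_measure)"
      by (simp only:) (intro integral_Re int continuous_intros)
    also have "(\<integral>z. 3 / 4 * (poly (A\<^sup>2) z * cnj (poly A z)) + 1 / 4 * poly (A ^ 3) z \<partial>circle_measure)
        = 3 / 4 * (\<Sum>n\<le>M. coeff (A\<^sup>2) n * cnj (coeff A n)) + 1 / 4 * coeff (A ^ 3) 0"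
      by (subst Bochner_Integration.integral_add)
         (auto intro!: int continuous_intros
           simp del: poly_power simp add: circle_integral_poly circle_integral_poly_cnj[OF deg(2) deg(1)])
    also have "Re \<dots> = 3 / 4 * T"
      by (simp add: T_def A0 power3_eq_cube coeff_mult)
    finally show ?thesis .
  qed
  have v: "v z = \<alpha> + g z" for z by (simp add: v_def g_def)
  \<comment> \<open>The deficit of the mean. The normalization reads
    \<open>\<alpha>\<^sup>2 + S / 2 = 1\<close>, so \<open>S\<close> and all error terms beside the
    Dirichlet form become polynomials in \<delta>, which lies in [0, 1].\<close>
  define \<delta> where "\<delta> = 1 - \<alpha>"
  have "(\<integral>z. v z \<partial>circle_measure) = \<alpha>"
    unfolding v by (subst Bochner_Integration.integral_add) (auto intro!: int continuous_intros simp: int1)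
  moreover have "0 \<le> (\<integral>z. v z \<partial>circle_measure)"
    by (rule Bochner_Integration.integral_nonneg_AE) (auto intro!: AE_I2 nn)
  ultimately have "\<alpha> \<ge> 0" by simp
  have "(\<integral>z. (v z)\<^sup>2 \<partial>circle_measure) = (\<integral>z. \<alpha>\<^sup>2 + (2 * \<alpha> * g z + (g z)\<^sup>2) \<partial>circle_measure)"
    by (simp add: v power2_eq_square algebra_simps)
  also have "\<dots> = \<alpha>\<^sup>2 + S / 2"
    by (simp add: Bochner_Integration.integral_add int continuous_intros int1 int2)
  finally have S: "S = 2 * (2 * \<delta> - \<delta>\<^sup>2)"
    using norm by (simp add: \<delta>_def power2_eq_square algebra_simps)
  have "S \<ge> 0" by (simp add: S_def sum_nonneg)
  then have "\<delta>\<^sup>2 \<le> 2 * \<delta>" using S by simp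
  have \<delta>: "0 \<le> \<delta>" "\<delta> \<le> 1"
    using \<open>\<delta>\<^sup>2 \<le> 2 * \<delta>\<close> zero_le_power2[of \<delta>] \<open>\<alpha> \<ge> 0\<close> by (linarith, simp add: \<delta>_def)
  have "(\<integral>z. (v z)\<^sup>2 * ln ((v z)\<^sup>2) \<partial>circle_measure)
      \<le> (\<integral>z. 2 * (v z - 1) + 3 * (v z - 1)\<^sup>2 + 2 / 3 * (v z - 1) ^ 3 \<partial>circle_measure)"
    unfolding v by (intro integral_mono int continuous_intros sq_ln_sq_le nn[unfolded v] continuous_on_x_ln) auto
  also have "\<dots> = (\<integral>z. (- 2 * \<delta> + 3 * \<delta>\<^sup>2 - 2 / 3 * \<delta> ^ 3) + ((2 - 6 * \<delta> + 2 * \<delta>\<^sup>2) * g z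
      + ((3 - 2 * \<delta>) * (g z)\<^sup>2 + 2 / 3 * (g z) ^ 3)) \<partial>circle_measure)"
  proof (intro Bochner_Integration.integral_cong refl)
    fix z
    have h: "v z - 1 = g z - \<delta>" by (simp add: v \<delta>_def)
    show "2 * (v z - 1) + 3 * (v z - 1)\<^sup>2 + 2 / 3 * (v z - 1) ^ 3
      = (- 2 * \<delta> + 3 * \<delta>\<^sup>2 - 2 / 3 * \<delta> ^ 3) + ((2 - 6 * \<delta> + 2 * \<delta>\<^sup>2) * g z
      + ((3 - 2 * \<delta>) * (g z)\<^sup>2 + 2 / 3 * (g z) ^ 3))"
      unfolding h by (simp add: power2_eq_square power3_eq_cube algebra_simps)
  qed
  also have "\<dots> = (- 2 * \<delta> + 3 * \<delta>\<^sup>2 - 2 / 3 * \<delta> ^ 3) + ((3 - 2 * \<delta>) * (S / 2) + T / 2)"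
    by (simp add: Bochner_Integration.integral_add int continuous_intros int1 int2 int3)
  also have "T / 2 \<le> (\<Sum>n\<le>M. (real n - 1) * (norm (coeff A n))\<^sup>2) + 1 / 16 * S\<^sup>2"
    using cubic_term_le[OF A0, of M] by (simp add: T_def S_def)
  also have "(\<Sum>n\<le>M. (real n - 1) * (norm (coeff A n))\<^sup>2)
      = (\<Sum>n\<le>M. real n * (norm (coeff A n))\<^sup>2) - S"
    by (simp add: S_def algebra_simps sum_subtractf)
  also have "(\<Sum>n\<le>M. real n * (norm (coeff A n))\<^sup>2)
      = (\<Sum>n\<le>degree A. real n * (norm (coeff A n))\<^sup>2)" (is "_ = ?E")
    using deg(1) by (intro sum.mono_neutral_right) (auto simp: coeff_eq_0)
  \<comment> \<open>The terms linear in \<delta> cancel, and the rest is at most 0 because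
    \<open>1 / 3 + 1 / 4 < 1\<close>.\<close>
  also have "(- 2 * \<delta> + 3 * \<delta>\<^sup>2 - 2 / 3 * \<delta> ^ 3)
        + ((3 - 2 * \<delta>) * (S / 2) + (?E - S + 1 / 16 * S\<^sup>2))
      = ?E + \<delta>\<^sup>2 * (- 1 + \<delta> / 3 + \<delta>\<^sup>2 / 4)"
    unfolding S by (simp add: power2_eq_square power3_eq_cube field_simps)
  also have "\<dots> \<le> ?E"
  proof -
    have "\<delta>\<^sup>2 \<le> 1" using \<delta> by (simp add: power_le_one)
    then have "\<delta>\<^sup>2 * (- 1 + \<delta> / 3 + \<delta>\<^sup>2 / 4) \<le> 0"
      using \<delta> by (intro mult_nonneg_nonpos) auto
    then show ?thesis by simp
  qed
  finally show ?thesis by simp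
qed

lemma log_sobolev_trig:
  fixes A :: "complex poly" and \<alpha> :: real
  defines "v \<equiv> \<lambda>z. \<alpha> + Re (poly A z)"
  assumes A0: "coeff A 0 = 0" and nn: "\<And>z. norm z = 1 \<Longrightarrow> 0 \<le> v z"
  defines "I \<equiv> \<integral>z. (v z)\<^sup>2 \<partial>circle_measure"
  assumes pos: "I > 0"
  shows "(\<integral>z. (v z)\<^sup>2 * ln ((v z)\<^sup>2) \<partial>circle_measure) - I * ln I
    \<le> (\<Sum>n\<le>degree A. real n * (norm (coeff A n))\<^sup>2)"
proof -
  \<comment> \<open>Both sides are homogeneous of degree 2 in \<open>v\<close>, so \<open>v\<close>
    may be divided by its \<open>L^2\<close> norm.\<close>
  define c where "c = 1 / sqrt I"
  have c: "c > 0" "c\<^sup>2 = 1 / I" using pos by (simp_all add: c_def power_divide)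
  define w where "w z = c * \<alpha> + Re (poly (smult (complex_of_real c) A) z)" for z
  have wv: "w z = c * v z" for z
    by (simp add: w_def v_def algebra_simps)
  have cont: "continuous_on X v" for X
    unfolding v_def by (intro continuous_intros)
  note int = integrable_circle_continuous
  have "(\<integral>z. (w z)\<^sup>2 \<partial>circle_measure) = 1"
    using pos by (simp add: wv power_mult_distrib c(2) I_def)
  then have "(\<integral>z. (w z)\<^sup>2 * ln ((w z)\<^sup>2) \<partial>circle_measure)
      \<le> (\<Sum>n\<le>degree (smult (complex_of_real c) A).
           real n * (norm (coeff (smult (complex_of_real c) A) n))\<^sup>2)"
    unfolding w_def using A0 nn c
    by (intro log_sobolev_trig_normalized) (simp_all add: wv[unfolded w_def] del: poly_smult)
  also have "\<dots> = (1 / I) * (\<Sum>n\<le>degree A. real n * (norm (coeff A n))\<^sup>2)"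
    using c by (simp add: norm_mult power_mult_distrib sum_distrib_left mult_ac)
  also have "(\<integral>z. (w z)\<^sup>2 * ln ((w z)\<^sup>2) \<partial>circle_measure)
      = (\<integral>z. (1 / I) * ((v z)\<^sup>2 * ln ((v z)\<^sup>2) - ln I * (v z)\<^sup>2) \<partial>circle_measure)"
  proof (intro Bochner_Integration.integral_cong refl)
    fix z
    show "(w z)\<^sup>2 * ln ((w z)\<^sup>2) = (1 / I) * ((v z)\<^sup>2 * ln ((v z)\<^sup>2) - ln I * (v z)\<^sup>2)"
      using pos by (cases "v z = 0") (simp_all add: wv power_mult_distrib c(2) ln_div field_simps)
  qed
  also have "\<dots> = (1 / I) * ((\<integral>z. (v z)\<^sup>2 * ln ((v z)\<^sup>2) \<partial>circle_measure) - I * ln I)"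
    by (simp add: I_def Bochner_Integration.integral_diff int cont continuous_intros continuous_on_x_ln)
  finally show ?thesis
    using pos by (simp only: mult_le_cancel_left_pos zero_less_divide_1_iff)
qed

section \<open>Squared moduli of polynomials\<close>

lemma sum_square_split_diagonal:
  fixes f :: "nat \<Rightarrow> nat \<Rightarrow> 'a::comm_monoid_add"
  shows "(\<Sum>j\<le>d. \<Sum>k\<le>d. f j k) = (\<Sum>j\<le>d. f j j) + (\<Sum>j\<le>d. \<Sum>k<j. f j k + f k j)"
proof (induction d)
  case (Suc d)
  have "(\<Sum>j\<le>Suc d. \<Sum>k\<le>Suc d. f j k)
      = (\<Sum>j\<le>d. \<Sum>k\<le>d. f j k) + f (Suc d) (Suc d) + (\<Sum>k\<le>d. f (Suc d) k + f k (Suc d))"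
    by (simp add: sum.distrib add_ac)
  then show ?case
    by (simp add: Suc add_ac lessThan_Suc_atMost)
qed simp

lemma sum_norm_sq_eq:
  fixes x :: "'a \<Rightarrow> complex"
  shows "(norm (\<Sum>j\<in>J. x j))\<^sup>2 = (\<Sum>j\<in>J. \<Sum>k\<in>J. Re (x j * cnj (x k)))"
proof -
  have "complex_of_real ((norm (\<Sum>j\<in>J. x j))\<^sup>2) = (\<Sum>j\<in>J. \<Sum>k\<in>J. x j * cnj (x k))"
    by (simp add: complex_norm_square sum_product del: of_real_power)
  then have "(norm (\<Sum>j\<in>J. x j))\<^sup>2 = Re (\<Sum>j\<in>J. \<Sum>k\<in>J. x j * cnj (x k))"
    by (metis Re_complex_of_real)
  then show ?thesis by (simp only: Re_sum)
qed

text \<open>For a symmetric sequence the kernel \<open>s - 2 |j - k|\<close> may be averaged with its reflection, which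
  gives twice the positive definite kernel \<open>min (\<mu> j) (\<mu> k)\<close> with \<open>\<mu> j = min j (s - j)\<close>.\<close>
lemma symmetric_kernel_le:
  fixes x :: "nat \<Rightarrow> complex"
  assumes sym: "\<And>j. j \<le> s \<Longrightarrow> x (s - j) = x j"
  shows "4 * Re (\<Sum>j\<le>s. \<Sum>k<j. of_nat (j - k) * (x j * cnj (x k))) \<le> s * (norm (\<Sum>j\<le>s. x j))\<^sup>2"
proof -
  define R where "R j k = Re (x j * cnj (x k))" for j k
  have R_sym: "R j k = R k j" for j k by (simp add: R_def algebra_simps)
  define X where "X = (\<Sum>j\<le>s. \<Sum>k\<le>s. \<bar>real j - real k\<bar> * R j k)"
  have "X = 2 * Re (\<Sum>j\<le>s. \<Sum>k<j. of_nat (j - k) * (x j * cnj (x k)))"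
  proof -
    have "X = (\<Sum>j\<le>s. \<Sum>k<j. 2 * (real (j - k) * R j k))"
      unfolding X_def sum_square_split_diagonal
      by (simp, intro sum.cong refl) (auto simp: R_sym[of k j for k j] of_nat_diff R_def algebra_simps)
    also have "\<dots> = 2 * (\<Sum>j\<le>s. \<Sum>k<j. Re (of_nat (j - k) * (x j * cnj (x k))))"
      by (simp add: R_def sum_distrib_left del: of_nat_diff)
    finally show ?thesis by (simp only: Re_sum)
  qed
  moreover have "2 * X \<le> s * (norm (\<Sum>j\<le>s. x j))\<^sup>2"
  proof -
    \<comment> \<open>This is \<open>min (\<mu> j) (\<mu> k)\<close>, counted as the number of
      intervals \<open>{l..s - l}\<close> that contain both indices. Each interval contributes a
      kernel of rank one, hence a square.\<close>
    define m where "m j k = real (card {l\<in>{1..s}. j \<in> {l..s - l} \<and> k \<in> {l..s - l}})" for j k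
    have m: "s - \<bar>real j - real k\<bar> - \<bar>real j + real k - s\<bar> = 2 * m j k"
      if "j \<le> s" "k \<le> s" for j k
    proof -
      have "{l\<in>{1..s}. j \<in> {l..s - l} \<and> k \<in> {l..s - l}} = {1..min (min j (s - j)) (min k (s - k))}"
        using that by auto
      then have "m j k = real (min (min j (s - j)) (min k (s - k)))"
        by (simp add: m_def)
      then show ?thesis using that by (auto simp: of_nat_diff min_def abs_if)
    qed
    \<comment> \<open>The reflection \<open>k \<mapsto> s - k\<close>, under which \<open>x\<close>
      is invariant, produces the second kernel.\<close>
    have "(\<Sum>k\<le>s. \<bar>real j - real k\<bar> * R j k) = (\<Sum>k\<le>s. \<bar>real j + real k - s\<bar> * R j k)" for j
      by (rule sum.reindex_bij_witness[of _ "\<lambda>k. s - k" "\<lambda>k. s - k"])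
         (auto simp: of_nat_diff R_def sym algebra_simps)
    then have "2 * X = (\<Sum>j\<le>s. \<Sum>k\<le>s. (\<bar>real j - real k\<bar> + \<bar>real j + real k - s\<bar>) * R j k)"
      by (simp add: X_def distrib_right sum.distrib sum_distrib_left)
    also have "\<dots> = (\<Sum>j\<le>s. \<Sum>k\<le>s. s * R j k - 2 * (m j k * R j k))"
    proof (intro sum.cong refl)
      fix j k assume "j \<in> {..s}" "k \<in> {..s}"
      then have "\<bar>real j - real k\<bar> + \<bar>real j + real k - s\<bar> = s - 2 * m j k"
        using m[of j k] by simp
      then show "(\<bar>real j - real k\<bar> + \<bar>real j + real k - s\<bar>) * R j k = s * R j k - 2 * (m j k * R j k)"
        by (simp only: left_diff_distrib mult.assoc)
    qed
    also have "\<dots> = s * (\<Sum>j\<le>s. \<Sum>k\<le>s. R j k) - 2 * (\<Sum>j\<le>s. \<Sum>k\<le>s. m j k * R j k)"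
      by (simp only: sum_subtractf sum_distrib_left)
    also have "(\<Sum>j\<le>s. \<Sum>k\<le>s. R j k) = (norm (\<Sum>j\<le>s. x j))\<^sup>2"
      by (simp add: sum_norm_sq_eq R_def)
    also have "(\<Sum>j\<le>s. \<Sum>k\<le>s. m j k * R j k) = (\<Sum>l\<in>{1..s}. (norm (\<Sum>j\<in>{l..s - l}. x j))\<^sup>2)"
    proof -
      have "(\<Sum>j\<le>s. \<Sum>k\<le>s. m j k * R j k)
          = (\<Sum>j\<le>s. \<Sum>k\<le>s. \<Sum>l\<in>{1..s}. if j \<in> {l..s - l} \<and> k \<in> {l..s - l} then R j k else 0)"
        by (intro sum.cong refl)
           (simp add: m_def sum.If_cases Int_def conj_commute)
      also have "\<dots> = (\<Sum>j\<le>s. \<Sum>l\<in>{1..s}. \<Sum>k\<le>s. if j \<in> {l..s - l} \<and> k \<in> {l..s - l} then R j k else 0)"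
        by (intro sum.cong refl sum.swap)
      also have "\<dots> = (\<Sum>l\<in>{1..s}. \<Sum>j\<le>s. \<Sum>k\<le>s. if j \<in> {l..s - l} \<and> k \<in> {l..s - l} then R j k else 0)"
        by (rule sum.swap)
      also have "\<dots> = (\<Sum>l\<in>{1..s}. \<Sum>j\<in>{l..s - l}. \<Sum>k\<in>{l..s - l}. R j k)"
      proof (rule sum.cong[OF refl])
        fix l assume "l \<in> {1..s}"
        have "(\<Sum>j\<le>s. \<Sum>k\<le>s. if j \<in> {l..s - l} \<and> k \<in> {l..s - l} then R j k else 0)
            = (\<Sum>j\<in>{l..s - l}. \<Sum>k\<le>s. if j \<in> {l..s - l} \<and> k \<in> {l..s - l} then R j k else 0)"
          by (rule sum.mono_neutral_right) auto
        also have "\<dots> = (\<Sum>j\<in>{l..s - l}. \<Sum>k\<in>{l..s - l}. R j k)"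
          by (intro sum.cong refl sum.mono_neutral_cong_right) auto
        finally show "(\<Sum>j\<le>s. \<Sum>k\<le>s. if j \<in> {l..s - l} \<and> k \<in> {l..s - l} then R j k else 0)
            = (\<Sum>j\<in>{l..s - l}. \<Sum>k\<in>{l..s - l}. R j k)" .
      qed
      finally show ?thesis by (simp add: sum_norm_sq_eq R_def)
    qed
    finally show ?thesis
      using sum_nonneg[of "{1..s}" "\<lambda>l. (norm (\<Sum>j\<in>{l..s - l}. x j))\<^sup>2"] by simp
  qed
  ultimately show ?thesis by simp
qed

text \<open>With \<open>c\<close> the coefficients of \<open>K\<close>, this compares the energies
  of \<open>|K|\<^sup>2\<close> and \<open>K\<^sup>2\<close>. In the expanded square,
  \<open>c (k + n) * cnj (c k) * cnj (c (l + n)) * c l\<close> is regrouped as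
  \<open>x j * cnj (x k)\<close> with \<open>x j = c j * c (s - j)\<close>, \<open>j = k + n\<close>
  and \<open>s = k + n + l\<close>. The weight \<open>n\<close> turns into \<open>j - k\<close>, and
  \<open>x\<close> is symmetric under \<open>j \<mapsto> s - j\<close>.\<close>

lemma autocorrelation_energy_le:
  fixes c :: "nat \<Rightarrow> complex"
  assumes c0: "\<And>n. n > d \<Longrightarrow> c n = 0"
  shows "(\<Sum>n\<in>{1..d}. real n * (norm (2 * (\<Sum>k\<le>d. c (k + n) * cnj (c k))))\<^sup>2)
    \<le> (\<Sum>s\<le>2 * d. real s * (norm (\<Sum>j\<le>s. c j * c (s - j)))\<^sup>2)"
proof -
  define g where "g = (\<lambda>(n, k, l). of_nat n * (c (k + n) * cnj (c k) * cnj (c (l + n) * cnj (c l))))"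
  define h where "h = (\<lambda>(s, j, k). of_nat (j - k) * ((c j * c (s - j)) * cnj (c k * c (s - k))))"
  define S where "S = {1..d} \<times> {..d} \<times> {..d}"
  define T where "T = (SIGMA s:{..2 * d}. SIGMA j:{..s}. {..<j})"
  have "sum g S = sum h T"
  \<comment> \<open>Both index sets contain positions beyond \<open>d\<close>, where a coefficient
    vanishes; only the nonzero terms are matched.\<close>
  proof (rule sum.reindex_bij_witness_not_neutral[of "{a \<in> S. g a = 0}" "{b \<in> T. h b = 0}" S
        "\<lambda>(s, j, k). (j - k, k, s - j)" "\<lambda>(n, k, l). (k + n + l, k + n, k)"])
    fix a assume a: "a \<in> S - {a \<in> S. g a = 0}"
    obtain n k l where nkl: "a = (n, k, l)" by (cases a)
    have "k + n \<le> d" using a c0[of "k + n"] by (fastforce simp: nkl g_def)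
    then show "(case a of (n, k, l) \<Rightarrow> (k + n + l, k + n, k)) \<in> T - {b \<in> T. h b = 0}"
      using a by (auto simp: nkl S_def T_def g_def h_def add.commute)
  next
    fix b assume b: "b \<in> T - {b \<in> T. h b = 0}"
    obtain s j k where sjk: "b = (s, j, k)" by (cases b)
    have "j \<le> d" "s - j \<le> d" using b c0[of j] c0[of "s - j"] by (fastforce simp: sjk h_def)+
    then show "(case b of (s, j, k) \<Rightarrow> (j - k, k, s - j)) \<in> S - {a \<in> S. g a = 0}"
      using b by (auto simp: sjk S_def T_def g_def h_def)
  qed (auto simp: S_def T_def g_def h_def add.commute)
  have "(\<Sum>n\<in>{1..d}. real n * (norm (2 * (\<Sum>k\<le>d. c (k + n) * cnj (c k))))\<^sup>2) = 4 * Re (sum g S)"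
  proof -
    have "real n * (norm (2 * (\<Sum>k\<le>d. c (k + n) * cnj (c k))))\<^sup>2
        = 4 * Re (\<Sum>k\<le>d. \<Sum>l\<le>d. g (n, k, l))" for n
    proof -
      have "real n * (norm (2 * (\<Sum>k\<le>d. c (k + n) * cnj (c k))))\<^sup>2
          = 4 * (real n * (norm (\<Sum>k\<le>d. c (k + n) * cnj (c k)))\<^sup>2)"
        by (simp add: norm_mult power_mult_distrib)
      also have "real n * (norm (\<Sum>k\<le>d. c (k + n) * cnj (c k)))\<^sup>2 = (\<Sum>k\<le>d. \<Sum>l\<le>d. Re (g (n, k, l)))"
        unfolding sum_norm_sq_eq sum_distrib_left
        by (simp add: g_def)
      finally show ?thesis by (simp only: Re_sum)
    qed
    then show ?thesis
      by (simp only: S_def sum.cartesian_product' sum_distrib_left Re_sum)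
  qed
  also have "\<dots> = (\<Sum>s\<le>2 * d. 4 * Re (\<Sum>j\<le>s. \<Sum>k<j. h (s, j, k)))"
  proof -
    have "sum h T = (\<Sum>s\<le>2 * d. \<Sum>j\<le>s. \<Sum>k<j. h (s, j, k))"
      by (simp add: T_def sum.Sigma[symmetric] sum.Sigma case_prod_unfold)
    then show ?thesis by (simp only: \<open>sum g S = sum h T\<close> Re_sum sum_distrib_left)
  qed
  also have "\<dots> \<le> (\<Sum>s\<le>2 * d. real s * (norm (\<Sum>j\<le>s. c j * c (s - j)))\<^sup>2)"
    unfolding h_def prod.case by (intro sum_mono symmetric_kernel_le) (simp add: mult.commute)
  finally show ?thesis .
qed

text \<open>The square root \<open>K\<close> of \<open>G = K\<^sup>2\<close> is what makes
  \<open>|G| = |K|\<^sup>2\<close> a nonnegative trigonometric polynomial, with autocorrelations of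
  \<open>coeff K\<close> as coefficients. By Parseval the integral on the right is
  \<open>sum n |G_n|^2\<close>.\<close>

lemma log_sobolev_poly_square:
  fixes K :: "complex poly"
  defines "I \<equiv> \<integral>z. norm (poly K z) ^ 4 \<partial>circle_measure"
  assumes pos: "I > 0"
  shows "(\<integral>z. norm (poly K z) ^ 4 * ln (norm (poly K z) ^ 4) \<partial>circle_measure) - I * ln I
    \<le> (\<integral>z. Re (z * poly (pderiv (K\<^sup>2)) z * cnj (poly (K\<^sup>2) z)) \<partial>circle_measure)"
proof -
  define d where "d = degree K"
  define c where "c = coeff K"
  have c0: "c n = 0" if "n > d" for n using that by (simp add: c_def d_def coeff_eq_0)
  define a where "a n = 2 * (\<Sum>k\<le>d. c (k + n) * cnj (c k))" for n
  define A where "A = (\<Sum>n\<in>{1..d}. monom (a n) n)"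
  define \<alpha> where "\<alpha> = (\<Sum>k\<le>d. (norm (c k))\<^sup>2)"
  have coeff_A: "coeff A n = (if n \<in> {1..d} then a n else 0)" for n
    by (simp add: A_def coeff_sum)
  have v: "\<alpha> + Re (poly A z) = (norm (poly K z))\<^sup>2" if z: "norm z = 1" for z
  proof -
    define y where "y j k = (c j * z ^ j) * cnj (c k * z ^ k)" for j k
    have "y k j = cnj (y j k)" for j k by (simp add: y_def mult_ac)
    then have y_sym: "Re (y k j) = Re (y j k)" for j k by (metis complex_cnj(1) complex.sel(1) cnj.sel(1))
    have zz: "z ^ (k + n) * cnj (z ^ k) = z ^ n" for n k
    proof -
      have "z ^ (k + n) * cnj (z ^ k) = z ^ n * (z * cnj z) ^ k"
        by (simp add: power_add power_mult_distrib)
      then show ?thesis using z by (simp add: complex_norm_square[symmetric])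
    qed
    have "(norm (poly K z))\<^sup>2 = (\<Sum>j\<le>d. \<Sum>k\<le>d. Re (y j k))"
      by (simp add: poly_altdef d_def[symmetric] c_def[symmetric] sum_norm_sq_eq y_def
          del: complex_cnj_mult complex_cnj_power)
    also have "\<dots> = (\<Sum>j\<le>d. Re (y j j)) + (\<Sum>j\<le>d. \<Sum>k<j. 2 * Re (y j k))"
      unfolding sum_square_split_diagonal
      by (intro arg_cong2[where f="(+)"] sum.cong refl) (simp add: y_sym)
    also have "(\<Sum>j\<le>d. Re (y j j)) = \<alpha>"
      unfolding \<alpha>_def y_def complex_norm_square[symmetric]
      by (intro sum.cong refl) (simp add: norm_mult norm_power z)
    \<comment> \<open>Off the diagonal the frequency is \<open>n = j - k\<close>; pairs with
      \<open>k + n > d\<close> may be added because \<open>c\<close> vanishes there.\<close>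
    also have "(\<Sum>j\<le>d. \<Sum>k<j. 2 * Re (y j k))
        = (\<Sum>(j, k)\<in>(SIGMA j:{..d}. {..<j}). 2 * Re (y j k))"
      by (simp add: sum.Sigma)
    also have "\<dots> = (\<Sum>(n, k)\<in>{1..d} \<times> {..d}. 2 * Re (y (k + n) k))"
      by (rule sum.reindex_bij_witness_not_neutral[of "{}" "{x \<in> {1..d} \<times> {..d}. snd x + fst x > d}" _
            "\<lambda>(n, k). (k + n, k)" "\<lambda>(j, k). (j - k, k)"])
         (auto simp: y_def c0)
    also have "\<dots> = (\<Sum>n\<in>{1..d}. \<Sum>k\<le>d. 2 * Re (y (k + n) k))"
      by (simp add: sum.cartesian_product)
    also have "\<dots> = Re (\<Sum>n\<in>{1..d}. a n * z ^ n)"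
    proof -
      have "(\<Sum>k\<le>d. 2 * Re (y (k + n) k)) = Re (a n * z ^ n)" for n
      proof -
        have "y (k + n) k = c (k + n) * cnj (c k) * z ^ n" for k
          using zz[of k n] by (simp add: y_def mult_ac)
        then show ?thesis
          by (simp add: a_def sum_distrib_left sum_distrib_right mult.assoc Re_sum)
      qed
      then show ?thesis by (simp only: Re_sum)
    qed
    finally show ?thesis by (simp add: A_def poly_sum poly_monom)
  qed
  define w where "w z = \<alpha> + Re (poly A z)" for z
  have w: "(w z)\<^sup>2 = norm (poly K z) ^ 4" if "norm z = 1" for z
    using v[OF that] by (simp add: w_def flip: power_mult)
  have I: "I = (\<integral>z. (w z)\<^sup>2 \<partial>circle_measure)"
    unfolding I_def by (intro Bochner_Integration.integral_cong) (simp_all add: w)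
  have "(\<integral>z. norm (poly K z) ^ 4 * ln (norm (poly K z) ^ 4) \<partial>circle_measure)
      = (\<integral>z. (w z)\<^sup>2 * ln ((w z)\<^sup>2) \<partial>circle_measure)"
    by (intro Bochner_Integration.integral_cong) (simp_all add: w)
  also have "\<dots> - I * ln I \<le> (\<Sum>n\<le>degree A. real n * (norm (coeff A n))\<^sup>2)"
    using log_sobolev_trig[of A \<alpha>] pos by (simp add: w_def[symmetric] I coeff_A v[folded w_def])
  also have "\<dots> = (\<Sum>n\<in>{1..d}. real n * (norm (a n))\<^sup>2)"
  proof -
    have "a n = 0" if "1 \<le> n" "n \<le> d" "\<not> n \<le> degree A" for n
      using coeff_A[of n] coeff_eq_0[of A n] that by simp
    then show ?thesis
      by (intro sum.mono_neutral_cong) (auto simp: coeff_A)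
  qed
  also have "\<dots> \<le> (\<Sum>s\<le>2 * d. real s * (norm (\<Sum>j\<le>s. c j * c (s - j)))\<^sup>2)"
    unfolding a_def using c0 by (rule autocorrelation_energy_le)
  also have "\<dots> = (\<Sum>s\<le>2 * d. Re (coeff (pCons 0 (pderiv (K\<^sup>2))) s * cnj (coeff (K\<^sup>2) s)))"
  proof (intro sum.cong refl)
    fix s
    have "coeff (pCons 0 (pderiv (K\<^sup>2))) s = of_nat s * coeff (K\<^sup>2) s"
      by (cases s) (simp_all add: coeff_pderiv)
    then have "Re (coeff (pCons 0 (pderiv (K\<^sup>2))) s * cnj (coeff (K\<^sup>2) s))
        = real s * (norm (coeff (K\<^sup>2) s))\<^sup>2"
      by (simp only: mult.assoc complex_norm_square[symmetric]) simp
    then show "real s * (norm (\<Sum>j\<le>s. c j * c (s - j)))\<^sup>2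
        = Re (coeff (pCons 0 (pderiv (K\<^sup>2))) s * cnj (coeff (K\<^sup>2) s))"
      by (simp only: c_def power2_eq_square[of K] coeff_mult)
  qed
  also have "\<dots> = Re (\<integral>z. poly (pCons 0 (pderiv (K\<^sup>2))) z * cnj (poly (K\<^sup>2) z) \<partial>circle_measure)"
  proof -
    have deg: "degree (K\<^sup>2) \<le> 2 * d"
      using degree_power_le[of K 2] by (simp add: d_def)
    moreover have "degree (pCons 0 (pderiv (K\<^sup>2))) \<le> 2 * d"
      using deg by (cases "degree (K\<^sup>2)") (auto simp: degree_pderiv degree_pCons_eq_if pderiv_eq_0_iff)
    ultimately show ?thesis
      by (subst circle_integral_poly_cnj) (simp_all only: Re_sum)
  qed
  also have "\<dots> = (\<integral>z. Re (z * poly (pderiv (K\<^sup>2)) z * cnj (poly (K\<^sup>2) z)) \<partial>circle_measure)"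
    by (subst integral_Re[symmetric])
       (auto intro!: integrable_circle_continuous continuous_intros simp del: poly_power)
  finally show ?thesis by simp
qed

section \<open>Holomorphic functions\<close>

lemma circle_integral_pos:
  fixes f :: "complex \<Rightarrow> real"
  assumes "continuous_on (sphere 0 1) f" "\<And>z. norm z = 1 \<Longrightarrow> f z > 0"
  shows "(\<integral>z. f z \<partial>circle_measure) > 0"
proof -
  have "(1::complex) \<in> sphere 0 1" by simp
  then obtain w where w: "w \<in> sphere 0 1" "\<And>z. z \<in> sphere 0 1 \<Longrightarrow> f w \<le> f z"
    using continuous_attains_inf[OF compact_sphere _ assms(1)] by blast
  have "(\<integral>z. f w \<partial>circle_measure) \<le> (\<integral>z. f z \<partial>circle_measure)"
    using w(2) by (intro integral_mono integrable_circle_continuous assms(1) continuous_intros) auto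
  then show ?thesis using assms(2)[of w] w(1) by simp
qed

text \<open>Values in a euclidean space let several sequences pass to the limit jointly. The uniform
  bound confines them to a ball, on which \<Phi> is bounded by compactness, so dominated convergence
  applies.\<close>

lemma circle_integral_limit:
  fixes f :: "nat \<Rightarrow> complex \<Rightarrow> 'b::euclidean_space" and \<Phi> :: "'b \<Rightarrow> real"
  assumes cont: "\<And>N. continuous_on (sphere 0 1) (f N)"
    and lim: "\<And>z. norm z = 1 \<Longrightarrow> (\<lambda>N. f N z) \<longlonglongrightarrow> g z"
    and bound: "\<And>N z. norm z = 1 \<Longrightarrow> norm (f N z) \<le> B"
    and \<Phi>: "continuous_on UNIV \<Phi>"
  shows "(\<lambda>N. \<integral>z. \<Phi> (f N z) \<partial>circle_measure) \<longlonglongrightarrow> (\<integral>z. \<Phi> (g z) \<partial>circle_measure)"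
proof -
  have "bounded (\<Phi> ` cball 0 B)"
    by (intro compact_imp_bounded compact_continuous_image continuous_on_subset[OF \<Phi>]) auto
  then obtain C where C: "\<And>x. norm x \<le> B \<Longrightarrow> norm (\<Phi> x) \<le> C"
    unfolding bounded_iff by (metis imageI mem_cball_0)
  have meas: "(\<lambda>z. \<Phi> (f N z)) \<in> borel_measurable circle_measure" for N
    by (intro measurable_circle_continuous continuous_on_compose2[OF \<Phi> cont]) auto
  have lim': "(\<lambda>N. \<Phi> (f N z)) \<longlonglongrightarrow> \<Phi> (g z)" if "z \<in> space circle_measure" for z
    using that by (intro continuous_on_tendsto_compose[OF \<Phi> lim]) auto
  show ?thesis
  proof (rule integral_dominated_convergence[where w="\<lambda>_. C"])
    show "(\<lambda>z. \<Phi> (g z)) \<in> borel_measurable circle_measure"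
      by (rule borel_measurable_LIMSEQ_metric[OF meas lim'])
  qed (use meas lim' C bound in auto)
qed

text \<open>Taylor partial sums. As the radius exceeds 1, the coefficients of \<open>F\<close> and
  of its derivative are absolutely summable, which gives bounds on the circle independent of
  \<open>N\<close>.\<close>

lemma holomorphic_poly_approx:
  assumes F: "F holomorphic_on ball 0 R" and R: "R > 1"
  obtains K :: "nat \<Rightarrow> complex poly" and B where
    "\<And>z. norm z = 1 \<Longrightarrow> (\<lambda>N. poly (K N) z) \<longlonglongrightarrow> F z"
    "\<And>z. norm z = 1 \<Longrightarrow> (\<lambda>N. poly (pderiv (K N)) z) \<longlonglongrightarrow> deriv F z"
    "\<And>N z. norm z = 1 \<Longrightarrow> norm (poly (K N) z) \<le> B"
    "\<And>N z. norm z = 1 \<Longrightarrow> norm (poly (pderiv (K N)) z) \<le> B"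
proof -
  define a where "a n = (deriv ^^ n) F 0 / fact n" for n
  have sums: "(\<lambda>n. a n * z ^ n) sums F z" if "norm z < R" for z
    using holomorphic_power_series[OF F, of z] that by (simp add: a_def)
  obtain \<rho> where \<rho>: "1 < \<rho>" "\<rho> < R" using R dense by blast
  obtain \<sigma> where \<sigma>: "1 < \<sigma>" "\<sigma> < \<rho>" using \<rho>(1) dense by blast
  have summ: "summable (\<lambda>n. a n * complex_of_real \<rho> ^ n)"
    using sums[of "complex_of_real \<rho>"] \<rho> by (auto simp: sums_iff)
  have a_abs: "summable (\<lambda>n. norm (a n))"
    using powser_insidea[OF summ, of 1] \<rho> by simp
  have "summable (\<lambda>n. diffs a n * complex_of_real \<sigma> ^ n)"
    by (rule termdiff_converges[of _ R]) (use sums \<sigma> \<rho> in \<open>auto simp: sums_iff\<close>)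
  then have diffs_abs: "summable (\<lambda>n. norm (diffs a n))"
    using powser_insidea[of "diffs a" "complex_of_real \<sigma>" 1] \<sigma> by simp
  have deriv: "deriv F z = (suminf (\<lambda>n. diffs a n * z ^ n))" if z: "norm z = 1" for z
  proof (rule DERIV_imp_deriv)
    have "((\<lambda>z. suminf (\<lambda>n. a n * z ^ n)) has_field_derivative (suminf (\<lambda>n. diffs a n * z ^ n))) (at z)"
      by (rule termdiffs_strong[OF summ]) (use z \<rho> in auto)
    then show "(F has_field_derivative (suminf (\<lambda>n. diffs a n * z ^ n))) (at z)"
      by (rule has_field_derivative_transform_within_open[of _ _ _ "ball 0 R"])
         (use z R sums in \<open>auto simp: sums_iff\<close>)
  qed
  \<comment> \<open>Powers up to \<open>N\<close>, so that the derivative is the partial sum over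
    \<open>n < N\<close>.\<close>
  define K where "K N = (\<Sum>n<Suc N. monom (a n) n)" for N
  have K: "poly (K N) z = (\<Sum>n<Suc N. a n * z ^ n)" for N z
    by (simp add: K_def poly_sum poly_monom)
  have K': "poly (pderiv (K N)) z = (\<Sum>n<N. diffs a n * z ^ n)" for N z
  proof -
    have "poly (pderiv (K N)) z = (\<Sum>n<Suc N. of_nat n * a n * z ^ (n - 1))"
      unfolding K_def by (simp only: higher_pderiv_sum[of 1, simplified] pderiv_monom poly_sum poly_monom)
    also have "\<dots> = (\<Sum>n<N. diffs a n * z ^ n)"
      by (subst sum.lessThan_Suc_shift) (simp add: diffs_def)
    finally show ?thesis .
  qed
  have bound: "norm (\<Sum>n<N. b n * z ^ n) \<le> (suminf (\<lambda>n. norm (b n)))"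
    if "summable (\<lambda>n. norm (b n))" "norm z = 1" for b :: "nat \<Rightarrow> complex" and z N
  proof -
    have "norm (\<Sum>n<N. b n * z ^ n) \<le> (\<Sum>n<N. norm (b n))"
      by (rule sum_norm_le) (simp add: norm_mult norm_power that)
    also have "\<dots> \<le> (suminf (\<lambda>n. norm (b n)))"
      by (rule sum_le_suminf) (use that in auto)
    finally show ?thesis .
  qed
  have conv: "(\<lambda>N. \<Sum>n<N. b n * z ^ n) \<longlonglongrightarrow> (suminf (\<lambda>n. b n * z ^ n))"
    if "summable (\<lambda>n. norm (b n))" "norm z = 1" for b :: "nat \<Rightarrow> complex" and z
    by (rule summable_LIMSEQ, rule summable_norm_cancel) (use that in \<open>simp add: norm_mult norm_power\<close>)
  show ?thesis
  proof (rule that[of K "(suminf (\<lambda>n. norm (a n))) + (suminf (\<lambda>n. norm (diffs a n)))"])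
    fix z :: complex assume z: "norm z = 1"
    have "(\<lambda>N. \<Sum>n<Suc N. a n * z ^ n) \<longlonglongrightarrow> F z"
      using sums[of z] z R LIMSEQ_Suc unfolding sums_def by force
    then show "(\<lambda>N. poly (K N) z) \<longlonglongrightarrow> F z" by (simp only: K)
    show "(\<lambda>N. poly (pderiv (K N)) z) \<longlonglongrightarrow> deriv F z"
      using conv[OF diffs_abs z] by (simp only: K' deriv[OF z])
    fix N
    show "norm (poly (K N) z) \<le> (suminf (\<lambda>n. norm (a n))) + (suminf (\<lambda>n. norm (diffs a n)))"
      using bound[OF a_abs z, of "Suc N"] suminf_nonneg[OF diffs_abs] unfolding K by simp
    show "norm (poly (pderiv (K N)) z) \<le> (suminf (\<lambda>n. norm (a n))) + (suminf (\<lambda>n. norm (diffs a n)))"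
      using bound[OF diffs_abs z, of N] suminf_nonneg[OF a_abs] unfolding K' by simp
  qed
qed

lemma log_sobolev_holomorphic:
  assumes H: "H holomorphic_on ball 0 R" and R: "R > 1"
  defines "I \<equiv> \<integral>z. exp (Re (H z)) \<partial>circle_measure"
  shows "(\<integral>z. exp (Re (H z)) * Re (H z) \<partial>circle_measure) - I * ln I
    \<le> 1 / 2 * (\<integral>z. exp (Re (H z)) * Re (z * deriv H z) \<partial>circle_measure)"
proof -
  \<comment> \<open>A square root of the zero-free function \<open>exp (H / 2)\<close>, whose
    squared modulus is \<open>exp (Re (H z))\<close>. The Taylor polynomials of \<open>F\<close> can
    play the role of \<open>K\<close> in \<open>log_sobolev_poly_square\<close>.\<close>
  define F where "F z = exp (H z / 4)" for z
  have F: "F holomorphic_on ball 0 R"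
    unfolding F_def by (intro holomorphic_intros H) auto
  obtain K B where K: "\<And>z. norm z = 1 \<Longrightarrow> (\<lambda>N. poly (K N) z) \<longlonglongrightarrow> F z"
    "\<And>z. norm z = 1 \<Longrightarrow> (\<lambda>N. poly (pderiv (K N)) z) \<longlonglongrightarrow> deriv F z"
    "\<And>N z. norm z = 1 \<Longrightarrow> norm (poly (K N) z) \<le> B"
    "\<And>N z. norm z = 1 \<Longrightarrow> norm (poly (pderiv (K N)) z) \<le> B"
    using holomorphic_poly_approx[OF F R] by blast
  \<comment> \<open>All integrands are continuous functions of this triple, so one limit statement
    covers mass, entropy and Dirichlet form.\<close>
  define f where "f N z = (z, poly (K N) z, poly (pderiv (K N)) z)" for N z
  define g where "g z = (z, F z, deriv F z)" for z
  have lim: "(\<lambda>N. \<integral>z. \<Phi> (f N z) \<partial>circle_measure) \<longlonglongrightarrow> (\<integral>z. \<Phi> (g z) \<partial>circle_measure)"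
    if "continuous_on UNIV \<Phi>" for \<Phi> :: "complex \<times> complex \<times> complex \<Rightarrow> real"
  proof (rule circle_integral_limit[OF _ _ _ that])
    fix N z assume z: "norm (z::complex) = 1"
    have "norm (f N z) \<le> norm z + (norm (poly (K N) z) + norm (poly (pderiv (K N)) z))"
      unfolding f_def by (intro order_trans[OF norm_Pair_le] add_left_mono norm_Pair_le)
    also have "\<dots> \<le> 1 + (B + B)"
      using z K(3,4) by (intro add_mono) auto
    finally show "norm (f N z) \<le> 1 + (B + B)" .
    show "(\<lambda>N. f N z) \<longlonglongrightarrow> g z"
      unfolding f_def g_def by (intro tendsto_intros K z)
  qed (auto simp: f_def intro!: continuous_intros)
  define J where "J N = (\<integral>z. norm (poly (K N) z) ^ 4 \<partial>circle_measure)" for N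
  have normF: "norm (F z) ^ 4 = exp (Re (H z))" for z
    by (simp add: F_def flip: exp_of_nat_mult)
  have derivF: "deriv F z = deriv H z / 4 * F z" if "norm z = 1" for z
  proof (rule DERIV_imp_deriv)
    have "(H has_field_derivative deriv H z) (at z)"
      using that R by (intro holomorphic_derivI[OF H]) auto
    then show "(F has_field_derivative deriv H z / 4 * F z) (at z)"
      unfolding F_def by (auto intro!: derivative_eq_intros)
  qed
  have J: "J \<longlonglongrightarrow> I"
    using lim[of "\<lambda>(z, k, l). norm k ^ 4"]
    by (simp add: J_def[abs_def] I_def f_def g_def normF case_prod_unfold continuous_intros)
  have "continuous_on (sphere 0 1) H"
    using R by (intro holomorphic_on_imp_continuous_on holomorphic_on_subset[OF H]) auto
  then have "I > 0"
    unfolding I_def by (intro circle_integral_pos continuous_intros) auto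
  then have ev: "eventually (\<lambda>N. J N > 0) sequentially"
    using J by (rule order_tendstoD(1)[rotated])
  have "(\<lambda>N. \<integral>z. norm (poly (K N) z) ^ 4 * ln (norm (poly (K N) z) ^ 4) \<partial>circle_measure)
      \<longlonglongrightarrow> (\<integral>z. exp (Re (H z)) * Re (H z) \<partial>circle_measure)"
    using lim[of "\<lambda>(z, k, l). norm k ^ 4 * ln (norm k ^ 4)"]
    by (simp add: f_def g_def normF case_prod_unfold continuous_intros continuous_on_x_ln)
  then have l: "(\<lambda>N. (\<integral>z. norm (poly (K N) z) ^ 4 * ln (norm (poly (K N) z) ^ 4) \<partial>circle_measure)
        - J N * ln (J N)) \<longlonglongrightarrow> (\<integral>z. exp (Re (H z)) * Re (H z) \<partial>circle_measure) - I * ln I"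
    using J \<open>I > 0\<close> by (intro tendsto_intros) auto
  have "(\<lambda>N. \<integral>z. Re (z * poly (pderiv ((K N)\<^sup>2)) z * cnj (poly ((K N)\<^sup>2) z)) \<partial>circle_measure)
      \<longlonglongrightarrow> (\<integral>z. Re (z * (2 * F z * deriv F z) * cnj ((F z)\<^sup>2)) \<partial>circle_measure)"
  proof -
    have "poly (pderiv (P\<^sup>2)) z = 2 * poly P z * poly (pderiv P) z" for P :: "complex poly" and z
      by (simp add: power2_eq_square pderiv_mult)
    moreover have "continuous_on UNIV (\<lambda>(z, k, l). Re (z * (2 * k * l) * cnj (k\<^sup>2)))"
      unfolding case_prod_unfold by (intro continuous_intros)
    ultimately show ?thesis
      using lim[of "\<lambda>(z, k, l). Re (z * (2 * k * l) * cnj (k\<^sup>2))"]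
      by (simp only: f_def g_def prod.case poly_power)
  qed
  also have "(\<integral>z. Re (z * (2 * F z * deriv F z) * cnj ((F z)\<^sup>2)) \<partial>circle_measure)
      = (\<integral>z. 1 / 2 * (exp (Re (H z)) * Re (z * deriv H z)) \<partial>circle_measure)"
  proof (intro Bochner_Integration.integral_cong refl)
    fix z assume "z \<in> space circle_measure"
    then have "z * (2 * F z * deriv F z) * cnj ((F z)\<^sup>2)
        = 1 / 2 * (z * deriv H z) * (F z * cnj (F z))\<^sup>2"
      by (simp add: derivF power2_eq_square)
    also have "(F z * cnj (F z))\<^sup>2 = complex_of_real (norm (F z) ^ 4)"
      by (simp add: complex_norm_square[symmetric] flip: power_mult)
    finally show "Re (z * (2 * F z * deriv F z) * cnj ((F z)\<^sup>2))
        = 1 / 2 * (exp (Re (H z)) * Re (z * deriv H z))"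
      by (simp only: normF) simp
  qed
  also have "\<dots> = 1 / 2 * (\<integral>z. exp (Re (H z)) * Re (z * deriv H z) \<partial>circle_measure)"
    by (rule integral_mult_right_zero)
  finally have r: "(\<lambda>N. \<integral>z. Re (z * poly (pderiv ((K N)\<^sup>2)) z * cnj (poly ((K N)\<^sup>2) z)) \<partial>circle_measure)
      \<longlonglongrightarrow> 1 / 2 * (\<integral>z. exp (Re (H z)) * Re (z * deriv H z) \<partial>circle_measure)" .
  show ?thesis
  proof (rule tendsto_le[OF _ r l])
    show "\<forall>\<^sub>F N in sequentially.
        (\<integral>z. norm (poly (K N) z) ^ 4 * ln (norm (poly (K N) z) ^ 4) \<partial>circle_measure) - J N * ln (J N)
        \<le> (\<integral>z. Re (z * poly (pderiv ((K N)\<^sup>2)) z * cnj (poly ((K N)\<^sup>2) z)) \<partial>circle_measure)"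
      using ev by eventually_elim (unfold J_def, rule log_sobolev_poly_square)
  qed simp
qed

text \<open>Along \<open>s \<mapsto> (s, sqrt (p / s))\<close> the derivative of \<open>ln M(s) / s\<close> is nonpositive exactly by the
  logarithmic Sobolev inequality.\<close>
lemma hypercontractive_exp:
  assumes h: "h holomorphic_on ball 0 R" and R: "R > 1" and pq: "0 < p" "p \<le> q"
  shows "(\<integral>z. exp (q * Re (h (complex_of_real (sqrt (p / q)) * z))) \<partial>circle_measure)
    \<le> (\<integral>z. exp (p * Re (h z)) \<partial>circle_measure) powr (q / p)"
proof -
  have Re_of_real_mult: "Re (complex_of_real r * z) = r * Re z" for r z
    by simp
  define \<rho> where "\<rho> s = sqrt (p / s)" for s
  have \<rho>: "0 < \<rho> s" "\<rho> s \<le> 1" if "p \<le> s" for s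
    using that pq by (auto simp: \<rho>_def)
  have d\<rho>: "(\<rho> has_real_derivative - \<rho> s / (2 * s)) (at s)" if "s > 0" for s
  proof -
    have "p / s > 0" using that pq by simp
    then have "((\<lambda>s. sqrt (p / s)) has_real_derivative (inverse (sqrt (p / s)) / 2) * (- p / s\<^sup>2)) (at s)"
      using that by (auto intro!: derivative_eq_intros simp: power2_eq_square)
    moreover have "p / s = (sqrt (p / s))\<^sup>2" using \<open>p / s > 0\<close> by simp
    then have "(inverse (sqrt (p / s)) / 2) * (- p / s\<^sup>2) = - sqrt (p / s) / (2 * s)"
      using that \<open>p / s > 0\<close> by (simp add: power2_eq_square field_simps)
    moreover have "\<rho> = (\<lambda>s. sqrt (p / s))" by (simp add: fun_eq_iff \<rho>_def)
    ultimately show ?thesis by (simp only:)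
  qed
  define w where "w s z = complex_of_real (\<rho> s) * z" for s z
  have w: "w s z \<in> ball 0 R" if "p \<le> s" "norm z = 1" for s z
    using \<rho>[OF that(1)] that(2) R by (simp add: w_def norm_mult)
  define G where "G s z = exp (s * Re (h (w s z)))" for s z
  \<comment> \<open>Since \<open>\<rho>' / \<rho> = - 1 / (2 * s)\<close>, the factor
    \<open>s\<close> of the exponent cancels, and the coefficient \<open>1 / 2\<close> of the
    logarithmic Sobolev inequality appears.\<close>
  define G' where "G' s z = G s z * (Re (h (w s z)) - 1 / 2 * Re (w s z * deriv h (w s z)))" for s z
  define M where "M s = (\<integral>z. G s z \<partial>circle_measure)" for s
  have cont_h: "continuous_on (ball 0 R) h" "continuous_on (ball 0 R) (deriv h)"
    using h by (auto intro!: holomorphic_on_imp_continuous_on holomorphic_deriv)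
  have cont_\<rho>: "continuous_on {p..q} \<rho>"
    unfolding \<rho>_def using pq by (intro continuous_intros) auto
  have cw: "continuous_on ({p..q} \<times> {0..2*pi}) (\<lambda>x. w (fst x) (cis (snd x)))"
    unfolding w_def by (intro continuous_intros continuous_on_compose2[OF cont_\<rho>]) auto
  have cG: "continuous_on (sphere 0 1) (G s)" if "p \<le> s" for s
    unfolding G_def
    by (intro continuous_intros continuous_on_compose2[OF cont_h(1)])
       (use w that in \<open>auto simp: w_def intro!: continuous_intros\<close>)
  have dG: "((\<lambda>s. G s z) has_real_derivative G' s z) (at s)" if "p \<le> s" "norm z = 1" for s z
  proof -
    have "s > 0" using that pq by simp
    have "((\<lambda>s. w s z) has_vector_derivative complex_of_real (- \<rho> s / (2 * s)) * z) (at s)"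
      unfolding w_def
      by (intro has_vector_derivative_mult_left has_vector_derivative_of_real
          d\<rho>[OF \<open>s > 0\<close>])
    moreover have "(h has_field_derivative deriv h (w s z)) (at (w s z))"
      using w[OF that] by (intro holomorphic_derivI[OF h]) auto
    ultimately have "((\<lambda>s. h (w s z)) has_vector_derivative
        (complex_of_real (- \<rho> s / (2 * s)) * z * deriv h (w s z))) (at s)"
      by (rule field_vector_diff_chain_at[unfolded o_def])
    then have "((\<lambda>s. Re (h (w s z))) has_real_derivative
        Re (complex_of_real (- \<rho> s / (2 * s)) * z * deriv h (w s z))) (at s)"
      unfolding has_real_derivative_iff_has_vector_derivative
      by (rule bounded_linear.has_vector_derivative[OF bounded_linear_Re])
    also have "complex_of_real (- \<rho> s / (2 * s)) * z * deriv h (w s z)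
        = complex_of_real (- 1 / (2 * s)) * (w s z * deriv h (w s z))"
      by (simp add: w_def)
    also have "Re \<dots> = - 1 / (2 * s) * Re (w s z * deriv h (w s z))"
      by (simp only: Re_of_real_mult)
    finally have d: "((\<lambda>s. Re (h (w s z))) has_real_derivative
        - 1 / (2 * s) * Re (w s z * deriv h (w s z))) (at s)" .
    have "((\<lambda>s. exp (s * \<phi> s)) has_real_derivative exp (s * \<phi> s) * (\<phi> s + s * D)) (at s)"
      if "(\<phi> has_real_derivative D) (at s)" for \<phi> :: "real \<Rightarrow> real" and D
      by (auto intro!: derivative_eq_intros that)
    from this[OF d] show ?thesis
      unfolding G_def G'_def using \<open>s > 0\<close> by (simp del: times_complex.sel)
  qed
  have M_eq: "M s = (1 / (2 * pi)) * integral {0..2 * pi} (\<lambda>t. G s (cis t))" if "p \<le> s" for s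
    using circle_integral_eq[OF cG[OF that]] by (simp add: M_def)
  have cws: "continuous_on (sphere 0 1) (w s)" for s
    unfolding w_def by (intro continuous_intros)
  have cG': "continuous_on (sphere 0 1) (G' s)" if "p \<le> s" for s
  proof -
    have "continuous_on (sphere 0 1) (\<lambda>z. h (w s z))"
      "continuous_on (sphere 0 1) (\<lambda>z. deriv h (w s z))"
      using w[OF that] by (auto intro: continuous_on_compose2[OF cont_h(1) cws]
          continuous_on_compose2[OF cont_h(2) cws])
    then show ?thesis
      unfolding G'_def by (intro continuous_intros cG[OF that] cws)
  qed
  have dM: "(M has_real_derivative (\<integral>z. G' s z \<partial>circle_measure)) (at s within {p..q})"
    if s: "s \<in> {p..q}" for s
  proof -
    have "((\<lambda>s. integral (cbox 0 (2 * pi)) (\<lambda>t. G s (cis t))) has_real_derivative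
        integral (cbox 0 (2 * pi)) (\<lambda>t. G' s (cis t))) (at s within {p..q})"
    proof (rule leibniz_rule_field_derivative[OF _ _ _ s])
      fix x t assume "x \<in> {p..q}"
      then show "((\<lambda>x. G x (cis t)) has_real_derivative G' x (cis t)) (at x within {p..q})"
        by (auto intro: has_field_derivative_at_within[OF dG])
    next
      fix x assume "x \<in> {p..q}"
      then show "(\<lambda>t. G x (cis t)) integrable_on cbox 0 (2 * pi)"
        by (intro integrable_continuous continuous_on_compose2[OF cG[of x]])
           (auto intro!: continuous_intros)
    next
      show "continuous_on ({p..q} \<times> cbox 0 (2 * pi)) (\<lambda>(x, t). G' x (cis t))"
      proof -
        have "continuous_on ({p..q} \<times> {0..2*pi}) (\<lambda>x. h (w (fst x) (cis (snd x))))"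
          "continuous_on ({p..q} \<times> {0..2*pi}) (\<lambda>x. deriv h (w (fst x) (cis (snd x))))"
          using w by (auto intro!: continuous_on_compose2[OF cont_h(1) cw]
              continuous_on_compose2[OF cont_h(2) cw])
        then show ?thesis
          unfolding G'_def G_def case_prod_unfold cbox_interval by (intro continuous_intros cw)
      qed
    qed simp
    then have "((\<lambda>s. (1 / (2 * pi)) * integral {0..2 * pi} (\<lambda>t. G s (cis t))) has_real_derivative
        (1 / (2 * pi)) * integral {0..2 * pi} (\<lambda>t. G' s (cis t))) (at s within {p..q})"
      by (intro DERIV_cmult) simp
    also have "(1 / (2 * pi)) * integral {0..2 * pi} (\<lambda>t. G' s (cis t)) = (\<integral>z. G' s z \<partial>circle_measure)"
      using circle_integral_eq[OF cG', of s] s by simp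
    finally show ?thesis
      by (rule has_field_derivative_transform_within[where d=1]) (use s in \<open>auto simp: M_eq\<close>)
  qed
  have M_pos: "M s > 0" if "p \<le> s" for s
    unfolding M_def by (intro circle_integral_pos cG that) (simp add: G_def)
  have key: "s * (\<integral>z. G' s z \<partial>circle_measure) \<le> M s * ln (M s)" if "p \<le> s" for s
  proof -
    \<comment> \<open>For this \<open>H\<close>, \<open>exp (Re (H z))\<close> is
      \<open>G s z\<close>, and \<open>s * G' s z\<close> is the entropy integrand minus half the
      Dirichlet integrand.\<close>
    define H where "H z = of_real s * h (w s z)" for z
    have wR: "w s z \<in> ball 0 R" if "z \<in> ball 0 R" for z
    proof -
      have "norm (w s z) \<le> norm z"
        using \<rho>[OF \<open>p \<le> s\<close>] by (simp add: w_def norm_mult mult_left_le_one_le)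
      then show ?thesis using that by simp
    qed
    have "H holomorphic_on ball 0 R"
      unfolding H_def
      by (intro holomorphic_intros holomorphic_on_compose_gen[OF _ h, unfolded o_def])
         (use wR in \<open>auto simp: w_def intro!: holomorphic_intros\<close>)
    note ls = log_sobolev_holomorphic[OF this R]
    have dH: "deriv H z = of_real s * (of_real (\<rho> s) * deriv h (w s z))" if "norm z = 1" for z
    proof (rule DERIV_imp_deriv)
      have "(h has_field_derivative deriv h (w s z)) (at (w s z))"
        using w[OF \<open>p \<le> s\<close> that] by (intro holomorphic_derivI[OF h]) auto
      then show "(H has_field_derivative of_real s * (of_real (\<rho> s) * deriv h (w s z))) (at z)"
        unfolding H_def w_def
        by (auto intro!: derivative_eq_intros DERIV_chain2[where f=h])
    qed
    have "continuous_on (sphere 0 1) (\<lambda>z. h (w s z))"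
      "continuous_on (sphere 0 1) (\<lambda>z. deriv h (w s z))"
      using w[OF that] by (auto intro: continuous_on_compose2[OF cont_h(1) cws]
          continuous_on_compose2[OF cont_h(2) cws])
    then have cont: "continuous_on (sphere 0 1) (\<lambda>z. Re (h (w s z)))"
      "continuous_on (sphere 0 1) (\<lambda>z. Re (w s z * deriv h (w s z)))"
      by - (intro continuous_intros cws; assumption)+
    have "s * (\<integral>z. G' s z \<partial>circle_measure) = (\<integral>z. s * G' s z \<partial>circle_measure)"
      by simp
    also have "\<dots> = (\<integral>z. exp (Re (H z)) * Re (H z) - 1 / 2 * (exp (Re (H z)) * Re (z * deriv H z)) \<partial>circle_measure)"
    proof (intro Bochner_Integration.integral_cong refl)
      fix z assume "z \<in> space circle_measure"
      then have "z * deriv H z = of_real s * (w s z * deriv h (w s z))"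
        by (simp add: dH w_def)
      then have "Re (z * deriv H z) = s * Re (w s z * deriv h (w s z))"
        by (simp only: Re_of_real_mult)
      moreover have "Re (H z) = s * Re (h (w s z))"
        by (simp add: H_def)
      ultimately show "s * G' s z
          = exp (Re (H z)) * Re (H z) - 1 / 2 * (exp (Re (H z)) * Re (z * deriv H z))"
        by (simp only: G'_def G_def) (simp add: algebra_simps)
    qed
    also have "\<dots> = (\<integral>z. exp (Re (H z)) * Re (H z) \<partial>circle_measure)
        - 1 / 2 * (\<integral>z. exp (Re (H z)) * Re (z * deriv H z) \<partial>circle_measure)"
    proof -
      have "continuous_on (sphere 0 1) (\<lambda>z. Re (H z))"
        unfolding H_def using cont(1) by (auto intro!: continuous_intros)
      moreover have "continuous_on (sphere 0 1) (\<lambda>z. Re (z * deriv H z))"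
      proof -
        have "continuous_on (sphere 0 1) (\<lambda>z. s * Re (w s z * deriv h (w s z)))"
          by (intro continuous_intros cont)
        moreover have "s * Re (w s z * deriv h (w s z)) = Re (z * deriv H z)" if "z \<in> sphere 0 1" for z
        proof -
          have "z * deriv H z = of_real s * (w s z * deriv h (w s z))"
            using that by (simp add: dH w_def)
          then show ?thesis by (simp only: Re_of_real_mult)
        qed
        ultimately show ?thesis by (rule continuous_on_eq)
      qed
      ultimately show ?thesis
        by (subst Bochner_Integration.integral_diff)
           (auto intro!: integrable_circle_continuous continuous_intros)
    qed
    also have "\<dots> \<le> M s * ln (M s)"
    proof -
      have "(\<integral>z. exp (Re (H z)) \<partial>circle_measure) = M s"
        by (simp add: M_def G_def H_def)
      then show ?thesis using ls by simp
    qed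
    finally show ?thesis .
  qed
  have "ln (M q) / q \<le> ln (M p) / p"
  \<comment> \<open>The derivative of \<open>M\<close> is known within \<open>{p..q}\<close>, hence
    two-sided only at interior points; continuity takes care of the ends.\<close>
  proof (rule DERIV_nonpos_imp_decreasing_open[OF pq(2)])
    fix s assume s: "p < s" "s < q"
    then have "s > 0" "M s > 0" using pq M_pos by auto
    have "at s within {p..q} = at s"
      using s by (intro at_within_interior) auto
    with dM[of s] s have "(M has_real_derivative (\<integral>z. G' s z \<partial>circle_measure)) (at s)"
      by simp
    then have "((\<lambda>s. ln (M s) / s) has_real_derivative
        (s * (\<integral>z. G' s z \<partial>circle_measure) - M s * ln (M s)) / (s * s * M s)) (at s)"
      using \<open>s > 0\<close> \<open>M s > 0\<close> by (auto intro!: derivative_eq_intros simp: field_simps)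
    moreover have "(s * (\<integral>z. G' s z \<partial>circle_measure) - M s * ln (M s)) / (s * s * M s) \<le> 0"
      using key[of s] s \<open>s > 0\<close> \<open>M s > 0\<close> by (intro divide_nonpos_pos) auto
    ultimately show "\<exists>y. ((\<lambda>s. ln (M s) / s) has_real_derivative y) (at s) \<and> y \<le> 0" by blast
  next
    have "continuous_on {p..q} M"
      using dM by (rule DERIV_continuous_on)
    then show "continuous_on {p..q} (\<lambda>s. ln (M s) / s)"
      by (intro continuous_intros) (use M_pos pq in force)+
  qed
  then have "ln (M q) \<le> q / p * ln (M p)"
    using pq by (simp add: field_simps)
  then have "exp (ln (M q)) \<le> exp (q / p * ln (M p))"
    by (simp only: exp_le_cancel_iff)
  then have "M q \<le> M p powr (q / p)"
    using M_pos[of p] M_pos[of q] pq by (simp add: powr_def)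
  then show ?thesis
    using pq by (simp add: M_def G_def w_def \<rho>_def)
qed

section \<open>Reflecting zeros out of the disc; the contraction in one variable\<close>

lemma norm_diff_le_norm_one_minus:
  assumes "norm z \<le> 1" "norm \<zeta> \<le> 1"
  shows "norm (z - \<zeta>) \<le> norm (1 - cnj \<zeta> * z)"
proof -
  \<comment> \<open>The identity by which the Blaschke factor
    \<open>(z - \<zeta>) / (1 - cnj \<zeta> * z)\<close> is bounded by 1 on the disc.\<close>
  have "(norm (1 - cnj \<zeta> * z))\<^sup>2 - (norm (z - \<zeta>))\<^sup>2 = (1 - (norm z)\<^sup>2) * (1 - (norm \<zeta>)\<^sup>2)"
    unfolding cmod_power2 by (simp add: power2_eq_square algebra_simps)
  also have "\<dots> \<ge> 0"
    using assms by (intro mult_nonneg_nonneg) (simp_all add: power_le_one)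
  finally show ?thesis
    by (simp add: power2_le_iff_abs_le)
qed

lemma norm_diff_eq_norm_one_minus:
  assumes "norm z = 1"
  shows "norm (1 - cnj \<zeta> * z) = norm (z - \<zeta>)"
proof -
  have "1 - cnj \<zeta> * z = z * cnj (z - \<zeta>)"
    using assms by (simp add: algebra_simps complex_norm_square[symmetric])
  then show ?thesis
    using assms by (metis complex_mod_cnj mult_1 norm_mult)
qed

text \<open>Each zero \<zeta> in the open disc is divided out by its Blaschke factor:
  \<open>z - \<zeta>\<close> becomes \<open>1 - cnj \<zeta> * z\<close>, which has no zero in the
  closed disc. Zeros on the circle stay.\<close>

lemma zero_free_majorant:
  fixes f :: "complex poly"
  assumes "f \<noteq> 0"
  obtains g where "\<And>z. norm z = 1 \<Longrightarrow> norm (poly g z) = norm (poly f z)"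
    "\<And>z. norm z \<le> 1 \<Longrightarrow> norm (poly f z) \<le> norm (poly g z)"
    "\<And>z. norm z < 1 \<Longrightarrow> poly g z \<noteq> 0"
proof -
  have "\<exists>g. (\<forall>z. norm z = 1 \<longrightarrow> norm (poly g z) = norm (poly f z)) \<and>
      (\<forall>z. norm z \<le> 1 \<longrightarrow> norm (poly f z) \<le> norm (poly g z)) \<and>
      (\<forall>z. norm z < 1 \<longrightarrow> poly g z \<noteq> 0)"
    using assms
  proof (induction "degree f" arbitrary: f)
    case 0
    then show ?case by (intro exI[of _ f]) (auto elim!: degree_eq_zeroE)
  next
    case (Suc d)
    then have "\<not> constant (poly f)" by (simp add: constant_degree)
    then obtain \<zeta> where "poly f \<zeta> = 0"
      using fundamental_theorem_of_algebra by blast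
    then obtain f1 where f: "f = [:-\<zeta>, 1:] * f1"
      by (auto simp: poly_eq_0_iff_dvd elim: dvdE)
    with Suc.prems have "f1 \<noteq> 0" by auto
    moreover from this have "degree f1 = d"
      using Suc.hyps(2) degree_mult_eq[of "[:-\<zeta>, 1:]" f1] by (simp only: f) simp
    ultimately obtain g1 where g1: "\<And>z. norm z = 1 \<Longrightarrow> norm (poly g1 z) = norm (poly f1 z)"
      "\<And>z. norm z \<le> 1 \<Longrightarrow> norm (poly f1 z) \<le> norm (poly g1 z)"
      "\<And>z. norm z < 1 \<Longrightarrow> poly g1 z \<noteq> 0"
      using Suc.hyps(1)[of f1] by blast
    define b where "b = (if norm \<zeta> < 1 then [:1, - cnj \<zeta>:] else [:-\<zeta>, 1:])"
    have pf: "poly f z = (z - \<zeta>) * poly f1 z" for z by (simp add: f algebra_simps)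
    have pb: "poly b z = (if norm \<zeta> < 1 then 1 - cnj \<zeta> * z else z - \<zeta>)" for z
      by (simp add: b_def mult.commute)
    have b0: "poly b z \<noteq> 0" if "norm z < 1" for z
    proof (cases "norm \<zeta> < 1")
      case True
      have "norm (cnj \<zeta> * z) \<le> norm z"
        using True by (simp add: norm_mult mult_left_le_one_le)
      then have "norm (cnj \<zeta> * z) < 1" using that by simp
      then show ?thesis using True by (auto simp: pb)
    next
      case False
      then show ?thesis using that by (auto simp: pb)
    qed
    have b1: "norm (poly b z) = norm (z - \<zeta>)" if "norm z = 1" for z
      using norm_diff_eq_norm_one_minus[OF that] by (simp add: pb)
    have b2: "norm (z - \<zeta>) \<le> norm (poly b z)" if "norm z \<le> 1" for z
      using norm_diff_le_norm_one_minus[OF that, of \<zeta>] by (simp add: pb)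
    show ?case
      using g1 b0 b1 b2
      by (intro exI[of _ "b * g1"]) (auto simp: pf norm_mult intro!: mult_mono)
  qed
  then show ?thesis using that by blast
qed

lemma hypercontractive_poly:
  fixes f :: "complex poly"
  assumes pq: "0 < p" "p \<le> q"
  shows "(\<integral>z. norm (poly f (complex_of_real (sqrt (p / q)) * z)) powr q \<partial>circle_measure)
    \<le> (\<integral>z. norm (poly f z) powr p \<partial>circle_measure) powr (q / p)"
proof (cases "f = 0")
  case True
  then show ?thesis using pq by simp
next
  case False
  define r where "r = complex_of_real (sqrt (p / q))"
  have r: "norm r \<le> 1" using pq by (simp add: r_def)
  obtain g where g: "\<And>z. norm z = 1 \<Longrightarrow> norm (poly g z) = norm (poly f z)"
    "\<And>z. norm z \<le> 1 \<Longrightarrow> norm (poly f z) \<le> norm (poly g z)"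
    "\<And>z. norm z < 1 \<Longrightarrow> poly g z \<noteq> 0"
    using zero_free_majorant[OF False] by blast
  \<comment> \<open>As \<open>g\<close> may vanish on the circle, the logarithm is taken of
    \<open>poly g (\<sigma> N * z)\<close>, which is zero-free on a disc of radius larger than 1;
    the dilation disappears in the limit. The shift in \<open>N + 2\<close> keeps
    \<open>\<sigma> N\<close> strictly between 0 and 1 even for \<open>N = 0\<close>.\<close>
  define \<sigma> where "\<sigma> N = complex_of_real (1 - 1 / real (N + 2))" for N
  have \<sigma>: "0 < norm (\<sigma> N)" "norm (\<sigma> N) < 1" for N
  proof -
    have "0 < 1 - 1 / real (N + 2)" "1 - 1 / real (N + 2) < 1" by simp_all
    then show "0 < norm (\<sigma> N)" "norm (\<sigma> N) < 1"
      unfolding \<sigma>_def norm_of_real by linarith+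
  qed
  have \<sigma>_lim: "\<sigma> \<longlonglongrightarrow> 1"
  proof -
    have "(\<lambda>N. 1 - 1 / real (N + 2)) \<longlonglongrightarrow> 1" by real_asymp
    then have "(\<lambda>N. complex_of_real (1 - 1 / real (N + 2))) \<longlonglongrightarrow> complex_of_real 1"
      by (rule tendsto_of_real)
    then show ?thesis by (simp add: \<sigma>_def[abs_def])
  qed
  have contr: "(\<integral>z. norm (poly g (\<sigma> N * (r * z))) powr q \<partial>circle_measure)
      \<le> (\<integral>z. norm (poly g (\<sigma> N * z)) powr p \<partial>circle_measure) powr (q / p)" for N
  proof -
    define R where "R = 1 / norm (\<sigma> N)"
    have R: "R > 1" using \<sigma>[of N] by (simp add: R_def)
    have "(\<lambda>z. poly g (\<sigma> N * z)) holomorphic_on ball 0 R"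
      by (intro holomorphic_intros)
    moreover have "poly g (\<sigma> N * z) \<noteq> 0" if "z \<in> ball 0 R" for z
      using that \<sigma>[of N] by (intro g(3)) (simp add: R_def norm_mult field_simps)
    moreover have "0 \<in> ball 0 R" using R by simp
    ultimately obtain h where h: "h holomorphic_on ball 0 R"
      "\<And>z. z \<in> ball 0 R \<Longrightarrow> exp (h z) = poly g (\<sigma> N * z)"
      using holomorphic_logarithm_exists[OF convex_ball open_ball] by blast
    have e: "norm (poly g (\<sigma> N * z)) powr s = exp (s * Re (h z))" if "norm z \<le> 1" for z s
      using h(2)[of z, symmetric] that R by (simp add: powr_def)
    have rz: "norm (r * z) \<le> 1" if "norm z \<le> 1" for z
      using r that by (simp add: norm_mult mult_le_one)
    have "(\<integral>z. norm (poly g (\<sigma> N * (r * z))) powr q \<partial>circle_measure)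
        = (\<integral>z. exp (q * Re (h (r * z))) \<partial>circle_measure)"
      by (intro Bochner_Integration.integral_cong refl e rz) simp
    also have "\<dots> \<le> (\<integral>z. exp (p * Re (h z)) \<partial>circle_measure) powr (q / p)"
      unfolding r_def by (rule hypercontractive_exp[OF h(1) R pq])
    also have "(\<integral>z. exp (p * Re (h z)) \<partial>circle_measure)
        = (\<integral>z. norm (poly g (\<sigma> N * z)) powr p \<partial>circle_measure)"
      by (intro Bochner_Integration.integral_cong refl e[symmetric]) simp
    finally show ?thesis .
  qed
  have lim: "(\<lambda>N. \<integral>z. norm (poly g (\<sigma> N * (c * z))) powr s \<partial>circle_measure)
      \<longlonglongrightarrow> (\<integral>z. norm (poly g (c * z)) powr s \<partial>circle_measure)" if c: "norm c \<le> 1" and "s > 0" for c s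
  proof -
    have "compact (poly g ` cball 0 1)"
      by (intro compact_continuous_image continuous_intros) auto
    then obtain B where B: "\<And>z. norm z \<le> 1 \<Longrightarrow> norm (poly g z) \<le> B"
      using compact_imp_bounded[THEN bounded_iff[THEN iffD1]] by (metis imageI mem_cball_0)
    show ?thesis
    proof (rule circle_integral_limit[where \<Phi>="\<lambda>x. norm x powr s" and B=B])
      fix N and z :: complex assume z: "norm z = 1"
      have "norm (\<sigma> N * (c * z)) \<le> 1"
        using \<sigma>[of N] c z by (simp add: norm_mult mult_le_one)
      then show "norm (poly g (\<sigma> N * (c * z))) \<le> B" by (rule B)
      have "(\<lambda>N. \<sigma> N * (c * z)) \<longlonglongrightarrow> 1 * (c * z)"
        by (intro tendsto_intros \<sigma>_lim)
      then have "(\<lambda>N. poly g (\<sigma> N * (c * z))) \<longlonglongrightarrow> poly g (1 * (c * z))"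
        by (rule tendsto_poly)
      then show "(\<lambda>N. poly g (\<sigma> N * (c * z))) \<longlonglongrightarrow> poly g (c * z)" by simp
    next
      show "continuous_on UNIV (\<lambda>x::complex. norm x powr s)"
        using \<open>s > 0\<close> by (intro continuous_on_powr' continuous_intros) auto
    qed (intro continuous_intros)
  qed
  have contq: "continuous_on (sphere 0 1) (\<lambda>z. norm (poly u (r * z)) powr q)" for u
    using pq by (intro continuous_on_powr' continuous_intros) auto
  have "(\<integral>z. norm (poly f (r * z)) powr q \<partial>circle_measure)
      \<le> (\<integral>z. norm (poly g (r * z)) powr q \<partial>circle_measure)"
    using r pq by (intro integral_mono integrable_circle_continuous contq powr_mono2 g(2))
      (auto simp: norm_mult)
  also have "\<dots> \<le> (\<integral>z. norm (poly g z) powr p \<partial>circle_measure) powr (q / p)"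
  proof (rule LIMSEQ_le)
    show "(\<lambda>N. \<integral>z. norm (poly g (\<sigma> N * (r * z))) powr q \<partial>circle_measure)
        \<longlonglongrightarrow> (\<integral>z. norm (poly g (r * z)) powr q \<partial>circle_measure)"
      using pq r by (intro lim) auto
    have "(\<lambda>N. \<integral>z. norm (poly g (\<sigma> N * z)) powr p \<partial>circle_measure)
        \<longlonglongrightarrow> (\<integral>z. norm (poly g z) powr p \<partial>circle_measure)"
      using lim[of 1 p] pq by simp
    then show "(\<lambda>N. (\<integral>z. norm (poly g (\<sigma> N * z)) powr p \<partial>circle_measure) powr (q / p))
        \<longlonglongrightarrow> (\<integral>z. norm (poly g z) powr p \<partial>circle_measure) powr (q / p)"
      using pq by (intro tendsto_powr2 tendsto_const) auto
  qed (use contr in auto)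
  also have "(\<integral>z. norm (poly g z) powr p \<partial>circle_measure) = (\<integral>z. norm (poly f z) powr p \<partial>circle_measure)"
    by (intro Bochner_Integration.integral_cong) (simp_all add: g(1))
  finally show ?thesis by (simp add: r_def)
qed

section \<open>Minkowski's inequality\<close>

text \<open>Convexity of \<open>t powr a\<close>: the graph lies above the tangent at
  \<open>c\<close>. Scaling by \<open>c\<close> leaves Bernoulli's inequality, which is Young's
  inequality with weights \<open>1 / a\<close> and \<open>1 - 1 / a\<close>.\<close>

lemma powr_tangent_le:
  fixes t c a :: real
  assumes "a \<ge> 1" "t \<ge> 0" "c > 0"
  shows "c powr a + a * c powr (a - 1) * (t - c) \<le> t powr a"
proof -
  have "t / c \<le> (t / c) powr a / a + (1 - 1 / a)"
  proof (cases "t = 0")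
    case False
    then have "((t / c) powr a) powr (1 / a) * 1 powr (1 - 1 / a)
        \<le> 1 / a * (t / c) powr a + (1 - 1 / a) * 1"
      using assms by (intro Youngs_inequality_0) auto
    then show ?thesis using assms False by (simp add: powr_powr)
  qed (use assms in auto)
  then have "a * (t / c) \<le> a * ((t / c) powr a / a + (1 - 1 / a))"
    using assms by (intro mult_left_mono) auto
  also have "\<dots> = (t / c) powr a + a - 1"
    using assms by (simp add: distrib_left right_diff_distrib)
  finally have "1 + a * (t / c - 1) \<le> (t / c) powr a"
    by (simp add: right_diff_distrib)
  then have "c powr a * (1 + a * (t / c - 1)) \<le> c powr a * (t / c) powr a"
    by (intro mult_left_mono) auto
  also have "c powr a * (t / c) powr a = t powr a"
    using assms by (simp add: powr_divide)
  also have "c powr a * (1 + a * (t / c - 1)) = c powr a + a * c powr (a - 1) * (t - c)"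
    using assms by (simp add: powr_diff field_simps)
  finally show ?thesis .
qed

text \<open>Jensen's inequality for the probability density proportional to \<open>b\<close> takes the place of Hoelder's.\<close>
lemma minkowski_integral_le:
  fixes F :: "'a \<times> 'b \<Rightarrow> real" and b :: "'b \<Rightarrow> real"
  assumes "prob_space M" "prob_space N"
    and F [measurable]: "F \<in> borel_measurable (M \<Otimes>\<^sub>M N)"
    and F_bd: "\<And>x y. x \<in> space M \<Longrightarrow> y \<in> space N \<Longrightarrow> 0 \<le> F (x, y) \<and> F (x, y) \<le> B"
    and b [measurable]: "b \<in> borel_measurable N"
    and b_bd: "\<And>y. y \<in> space N \<Longrightarrow> 0 \<le> b y \<and> b y \<le> B"
    and a: "a \<ge> 1"
    and le: "\<And>y. y \<in> space N \<Longrightarrow> (\<integral>x. F (x, y) powr a \<partial>M) \<le> b y powr a"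
  shows "(\<integral>x. (\<integral>y. F (x, y) \<partial>N) powr a \<partial>M) \<le> (\<integral>y. b y \<partial>N) powr a"
proof -
  interpret M: prob_space M by fact
  interpret N: prob_space N by fact
  interpret pair_prob_space M N ..
  \<comment> \<open>\<open>b\<close> may vanish, whereas the power with exponent
    \<open>1 - a \<le> 0\<close> below has to stay bounded; hence the shift by \<epsilon>.\<close>
  have eps: "(\<integral>x. (\<integral>y. F (x, y) \<partial>N) powr a \<partial>M) \<le> ((\<integral>y. b y \<partial>N) + \<epsilon>) powr a" if \<epsilon>: "\<epsilon> > 0" for \<epsilon>
  proof -
    define c where "c y = b y + \<epsilon>" for y
    have [measurable]: "c \<in> borel_measurable N" unfolding c_def by measurable
    have c: "c y \<ge> \<epsilon>" "c y > 0" "b y \<le> c y" "c y \<le> B + \<epsilon>" if "y \<in> space N" for y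
      using b_bd[OF that] \<epsilon> by (auto simp: c_def)
    define S where "S = (\<integral>y. c y \<partial>N)"
    have int_b: "integrable N b"
      by (rule N.integrable_const_bound[of _ B]) (use b_bd in auto)
    have S_eq: "S = (\<integral>y. b y \<partial>N) + \<epsilon>"
      unfolding S_def c_def using int_b by (simp add: N.prob_space)
    have "(\<integral>y. b y \<partial>N) \<ge> 0"
      by (rule Bochner_Integration.integral_nonneg) (use b_bd in auto)
    then have S: "S > 0" using S_eq \<epsilon> by simp
    have int_c: "integrable N c" unfolding c_def using int_b by simp
    \<comment> \<open>\<open>W = (F / c) powr a * c\<close>. Jensen's inequality in \<open>y\<close>
      bounds the left side by \<open>S powr (a - 1)\<close> times the double integral of
      \<open>W\<close>; integrating over \<open>x\<close> first then brings in the hypothesis on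
      \<open>b\<close>.\<close>
    define W where "W = (\<lambda>(x, y). F (x, y) powr a * c y powr (1 - a))"
    have [measurable]: "W \<in> borel_measurable (M \<Otimes>\<^sub>M N)"
      unfolding W_def by measurable
    define D where "D = B powr a * \<epsilon> powr (1 - a)"
    have W_bd: "0 \<le> W (x, y)" "W (x, y) \<le> D" if "x \<in> space M" "y \<in> space N" for x y
    proof -
      have "F (x, y) powr a \<le> B powr a"
        using F_bd[OF that] a by (intro powr_mono2) auto
      moreover have "c y powr (1 - a) \<le> \<epsilon> powr (1 - a)"
        using c[OF that(2)] a \<epsilon> by (intro powr_mono2') auto
      ultimately show "0 \<le> W (x, y)" "W (x, y) \<le> D"
        unfolding W_def D_def prod.case by (auto intro: mult_mono)
    qed
    have int_W: "integrable (M \<Otimes>\<^sub>M N) W"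
      by (rule P.integrable_const_bound[of _ D]) (use W_bd in \<open>auto simp: space_pair_measure\<close>)
    have pt: "(\<integral>y. F (x, y) \<partial>N) powr a \<le> S powr (a - 1) * (\<integral>y. W (x, y) \<partial>N)" if x: "x \<in> space M" for x
    proof -
      define G where "G = (\<integral>y. F (x, y) \<partial>N)"
      have Fx [measurable]: "(\<lambda>y. F (x, y)) \<in> borel_measurable N"
        using measurable_compose[OF measurable_Pair1'[OF x] F] .
      have Wx [measurable]: "(\<lambda>y. W (x, y)) \<in> borel_measurable N"
        using measurable_compose[OF measurable_Pair1'[OF x]] by measurable
      have int_F: "integrable N (\<lambda>y. F (x, y))"
        by (rule N.integrable_const_bound[of _ B]) (use F_bd x in auto)
      have int_Wx: "integrable N (\<lambda>y. W (x, y))"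
        by (rule N.integrable_const_bound[of _ D]) (use W_bd x in auto)
      have "G \<ge> 0"
        unfolding G_def by (rule Bochner_Integration.integral_nonneg) (use F_bd x in auto)
      have W_nn: "(\<integral>y. W (x, y) \<partial>N) \<ge> 0"
        by (rule Bochner_Integration.integral_nonneg) (use W_bd x in auto)
      show ?thesis
      proof (cases "G = 0")
        case True
        then show ?thesis using W_nn by (simp add: G_def[symmetric])
      next
        case False
        \<comment> \<open>The mean of \<open>F / c\<close> under the density \<open>c / S\<close>;
          with the tangent at this point the linear term integrates to 0.\<close>
        define k where "k = G / S"
        have k: "k > 0" using False \<open>G \<ge> 0\<close> S by (simp add: k_def)
        have "k powr a * c y + a * k powr (a - 1) * (F (x, y) - k * c y) \<le> W (x, y)"
          if y: "y \<in> space N" for y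
        proof -
          have "(k powr a + a * k powr (a - 1) * (F (x, y) / c y - k)) * c y
              \<le> (F (x, y) / c y) powr a * c y"
            using c[OF y] F_bd[OF x y] k a
            by (intro mult_right_mono powr_tangent_le) auto
          also have "\<dots> = W (x, y)"
            using c[OF y] F_bd[OF x y] by (simp add: W_def powr_divide powr_diff)
          also have "(k powr a + a * k powr (a - 1) * (F (x, y) / c y - k)) * c y
              = k powr a * c y + a * k powr (a - 1) * (F (x, y) - k * c y)"
            using c[OF y] by (simp add: field_simps)
          finally show ?thesis .
        qed
        then have "(\<integral>y. k powr a * c y + a * k powr (a - 1) * (F (x, y) - k * c y) \<partial>N)
            \<le> (\<integral>y. W (x, y) \<partial>N)"
          using int_c int_F int_Wx by (intro integral_mono) auto
        also have "(\<integral>y. k powr a * c y + a * k powr (a - 1) * (F (x, y) - k * c y) \<partial>N)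
            = k powr a * S + a * k powr (a - 1) * (G - k * S)"
          using int_c int_F by (simp add: S_def G_def)
        also have "\<dots> = k powr a * S"
          using S by (simp add: k_def)
        finally have "S powr (a - 1) * (k powr a * S) \<le> S powr (a - 1) * (\<integral>y. W (x, y) \<partial>N)"
          by (intro mult_left_mono) auto
        also have "S powr (a - 1) * (k powr a * S) = G powr a"
          using S \<open>G \<ge> 0\<close> by (simp add: k_def powr_divide powr_diff)
        finally show ?thesis by (simp add: G_def)
      qed
    qed
    have int_W1: "integrable M (\<lambda>x. \<integral>y. W (x, y) \<partial>N)"
      using integrable_fst'[OF int_W] .
    have [measurable]: "(\<lambda>x. \<integral>y. F (x, y) \<partial>N) \<in> borel_measurable M"
      by (rule N.borel_measurable_lebesgue_integral) simp
    have "(\<integral>x. (\<integral>y. F (x, y) \<partial>N) powr a \<partial>M) \<le> (\<integral>x. S powr (a - 1) * (\<integral>y. W (x, y) \<partial>N) \<partial>M)"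
    proof (rule integral_mono)
      show int2: "integrable M (\<lambda>x. S powr (a - 1) * (\<integral>y. W (x, y) \<partial>N))"
        using int_W1 by simp
      then show "integrable M (\<lambda>x. (\<integral>y. F (x, y) \<partial>N) powr a)"
        by (rule Bochner_Integration.integrable_bound) (use pt in \<open>auto intro!: AE_I2 order_trans[OF pt]\<close>)
    qed (rule pt)
    also have "\<dots> = S powr (a - 1) * (\<integral>x. (\<integral>y. W (x, y) \<partial>N) \<partial>M)" by simp
    also have "(\<integral>x. (\<integral>y. W (x, y) \<partial>N) \<partial>M) = (\<integral>y. (\<integral>x. W (x, y) \<partial>M) \<partial>N)"
      using Fubini_integral[of "\<lambda>x y. W (x, y)"] int_W by simp
    also have "\<dots> \<le> (\<integral>y. c y \<partial>N)"
    proof (rule integral_mono)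
      show "integrable N (\<lambda>y. \<integral>x. W (x, y) \<partial>M)"
        using integrable_snd[of "\<lambda>x y. W (x, y)"] int_W by simp
      show "integrable N c" by fact
      fix y assume y: "y \<in> space N"
      have "(\<integral>x. W (x, y) \<partial>M) = (\<integral>x. F (x, y) powr a \<partial>M) * c y powr (1 - a)"
        by (simp add: W_def)
      also have "\<dots> \<le> b y powr a * c y powr (1 - a)"
        by (intro mult_right_mono le y) auto
      also have "\<dots> \<le> c y powr a * c y powr (1 - a)"
        using b_bd[OF y] c[OF y] a by (intro mult_right_mono powr_mono2) auto
      also have "\<dots> = c y"
        using c[OF y] by (simp add: powr_add[symmetric])
      finally show "(\<integral>x. W (x, y) \<partial>M) \<le> c y" .
    qed
    also have "S powr (a - 1) * (\<integral>y. c y \<partial>N) = S powr a"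
      using S by (simp add: S_def[symmetric] powr_diff)
    finally show ?thesis by (simp add: S_eq mult_left_mono)
  qed
  have "((\<lambda>\<epsilon>. ((\<integral>y. b y \<partial>N) + \<epsilon>) powr a) \<longlongrightarrow> ((\<integral>y. b y \<partial>N) + 0) powr a) (at_right 0)"
  proof (rule tendsto_powr2)
    show "((\<lambda>\<epsilon>. (\<integral>y. b y \<partial>N) + \<epsilon>) \<longlongrightarrow> (\<integral>y. b y \<partial>N) + 0) (at_right 0)"
      by (intro tendsto_add tendsto_const tendsto_ident_at)
    have "(\<integral>y. b y \<partial>N) \<ge> 0"
      by (rule Bochner_Integration.integral_nonneg) (use b_bd in auto)
    then show "\<forall>\<^sub>F \<epsilon> in at_right 0. 0 \<le> (\<integral>y. b y \<partial>N) + \<epsilon>"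
      by (intro eventually_at_right_less[THEN eventually_mono]) auto
  qed (use a in auto)
  then show ?thesis
    by (intro tendsto_lowerbound[of "\<lambda>\<epsilon>. ((\<integral>y. b y \<partial>N) + \<epsilon>) powr a" _ "at_right 0"])
       (auto intro!: eventually_at_right_less[THEN eventually_mono] eps)
qed

section \<open>The torus\<close>

text \<open>Generating the functions inductively, rather than from coefficients, lets scaling,
  freezing a coordinate and slicing in one variable be handled by rule induction.\<close>

inductive_set polyfun :: "nat \<Rightarrow> ((nat \<Rightarrow> complex) \<Rightarrow> complex) set" for n where
  polyfun_const: "(\<lambda>_. c) \<in> polyfun n"
| polyfun_coord: "i < n \<Longrightarrow> (\<lambda>z. z i) \<in> polyfun n"
| polyfun_add: "F \<in> polyfun n \<Longrightarrow> G \<in> polyfun n \<Longrightarrow> (\<lambda>z. F z + G z) \<in> polyfun n"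
| polyfun_mult: "F \<in> polyfun n \<Longrightarrow> G \<in> polyfun n \<Longrightarrow> (\<lambda>z. F z * G z) \<in> polyfun n"

lemma polyfun_sum: "(\<And>a. a \<in> A \<Longrightarrow> F a \<in> polyfun n) \<Longrightarrow> (\<lambda>z. \<Sum>a\<in>A. F a z) \<in> polyfun n"
  by (induction A rule: infinite_finite_induct) (auto intro: polyfun.intros)

lemma polyfun_prod: "(\<And>a. a \<in> A \<Longrightarrow> F a \<in> polyfun n) \<Longrightarrow> (\<lambda>z. \<Prod>a\<in>A. F a z) \<in> polyfun n"
  by (induction A rule: infinite_finite_induct) (auto intro: polyfun.intros)

lemma polyfun_power: "F \<in> polyfun n \<Longrightarrow> (\<lambda>z. F z ^ k) \<in> polyfun n"
  by (induction k) (auto intro: polyfun.intros)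

lemma polyfun_scale: "F \<in> polyfun n \<Longrightarrow> (\<lambda>z. F (\<lambda>i. c * z i)) \<in> polyfun n"
  by (induction rule: polyfun.induct) (auto intro: polyfun.intros)

text \<open>Used with \<open>m = Suc n\<close>: the half-way function of the inductions over the
  dimension, transformed in all coordinates but the last.\<close>

lemma polyfun_scale_below: "F \<in> polyfun m \<Longrightarrow> (\<lambda>z. F (\<lambda>i. if i < n then c * z i else z i)) \<in> polyfun m"
proof (induction rule: polyfun.induct)
  case (polyfun_coord i)
  then show ?case
    using polyfun_mult[OF polyfun_const polyfun.polyfun_coord] by (cases "i < n") (auto intro: polyfun.polyfun_coord)
qed (auto intro: polyfun.intros)

lemma polyfun_update: "F \<in> polyfun (Suc n) \<Longrightarrow> (\<lambda>z. F (z(n := w))) \<in> polyfun n"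
proof (induction rule: polyfun.induct)
  case (polyfun_coord i)
  then show ?case by (cases "i = n") (auto intro: polyfun.intros)
qed (auto intro: polyfun.intros)

lemma polyfun_slice: "F \<in> polyfun m \<Longrightarrow> \<exists>P. \<forall>w. F (z(n := w)) = poly P w"
proof (induction rule: polyfun.induct)
  case (polyfun_const c)
  show ?case by (intro exI[of _ "[:c:]"]) simp
next
  case (polyfun_coord i)
  show ?case by (intro exI[of _ "if i = n then [:0, 1:] else [:z i:]"]) simp
next
  case (polyfun_add F G)
  then show ?case by (metis poly_add)
next
  case (polyfun_mult F G)
  then show ?case by (metis poly_mult)
qed

lemma polyfun_cong: "F \<in> polyfun n \<Longrightarrow> (\<And>i. i < n \<Longrightarrow> z i = z' i) \<Longrightarrow> F z = F z'"
  by (induction rule: polyfun.induct) auto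

lemma polyfun_bounded: "F \<in> polyfun n \<Longrightarrow> \<exists>B. \<forall>z. (\<forall>i<n. norm (z i) \<le> 1) \<longrightarrow> norm (F z) \<le> B"
proof (induction rule: polyfun.induct)
  case (polyfun_add F G)
  then show ?case by (meson norm_triangle_mono)
next
  case (polyfun_mult F G)
  then obtain A B where "\<forall>z. (\<forall>i<n. norm (z i) \<le> 1) \<longrightarrow> norm (F z) \<le> A"
    "\<forall>z. (\<forall>i<n. norm (z i) \<le> 1) \<longrightarrow> norm (G z) \<le> B" by blast
  then show ?case
    by (intro exI[of _ "A * B"]) (auto simp: norm_mult intro!: mult_mono intro: order_trans[OF norm_ge_zero])
qed auto

interpretation torus: product_sigma_finite "\<lambda>_::nat. circle_measure" ..

lemma prob_space_torus_measure: "prob_space (torus_measure n)"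
  unfolding torus_measure_def by (intro prob_space_PiM prob_space_circle_measure)

lemma norm_torus: "z \<in> space (torus_measure n) \<Longrightarrow> i < n \<Longrightarrow> norm (z i) = 1"
  by (auto simp: torus_measure_def space_PiM PiE_def Pi_def)

lemma measurable_torus_polyfun: "F \<in> polyfun n \<Longrightarrow> F \<in> borel_measurable (torus_measure n)"
proof (induction rule: polyfun.induct)
  case (polyfun_coord i)
  have "(\<lambda>z. z i) \<in> torus_measure n \<rightarrow>\<^sub>M circle_measure"
    unfolding torus_measure_def using polyfun_coord by (intro measurable_component_singleton) simp
  moreover have "(\<lambda>w. w) \<in> borel_measurable circle_measure"
    by (intro measurable_circle_continuous continuous_intros)
  ultimately show ?case by (rule measurable_compose)
qed auto

lemma measurable_torus_update:
  "(\<lambda>(z, w). z(n := w)) \<in> torus_measure n \<Otimes>\<^sub>M circle_measure \<rightarrow>\<^sub>M torus_measure (Suc n)"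
  unfolding torus_measure_def lessThan_Suc by (rule measurable_add_dim)

lemma continuous_compose_measurable:
  fixes \<Phi> :: "complex \<Rightarrow> real"
  assumes "continuous_on UNIV \<Phi>" "F \<in> borel_measurable M"
  shows "(\<lambda>z. \<Phi> (F z)) \<in> borel_measurable M"
  using measurable_compose[OF assms(2) borel_measurable_continuous_onI[OF assms(1)]] .

lemma polyfun_compose_bounded:
  fixes \<Phi> :: "complex \<Rightarrow> real"
  assumes \<Phi>: "continuous_on UNIV \<Phi>" and F: "F \<in> polyfun n"
  obtains B where "\<And>z. (\<And>i. i < n \<Longrightarrow> norm (z i) \<le> 1) \<Longrightarrow> norm (\<Phi> (F z)) \<le> B"
proof -
  obtain C where C: "\<And>z. (\<And>i. i < n \<Longrightarrow> norm (z i) \<le> 1) \<Longrightarrow> norm (F z) \<le> C"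
    using polyfun_bounded[OF F] by blast
  have "bounded (\<Phi> ` cball 0 C)"
    by (intro compact_imp_bounded compact_continuous_image continuous_on_subset[OF \<Phi>]) auto
  then obtain B where "\<And>x. norm x \<le> C \<Longrightarrow> norm (\<Phi> x) \<le> B"
    unfolding bounded_iff by (metis imageI mem_cball_0)
  with C that show ?thesis by blast
qed

lemma integrable_torus:
  fixes \<Phi> :: "complex \<Rightarrow> real"
  assumes \<Phi>: "continuous_on UNIV \<Phi>" and F: "F \<in> polyfun n"
  shows "integrable (torus_measure n) (\<lambda>z. \<Phi> (F z))"
proof -
  interpret prob_space "torus_measure n" by (rule prob_space_torus_measure)
  obtain B where "\<And>z. (\<And>i. i < n \<Longrightarrow> norm (z i) \<le> 1) \<Longrightarrow> norm (\<Phi> (F z)) \<le> B"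
    using polyfun_compose_bounded[OF \<Phi> F] by blast
  then show ?thesis
    by (intro integrable_const_bound[of _ B] AE_I2 continuous_compose_measurable \<Phi>
        measurable_torus_polyfun F) (simp add: norm_torus)
qed

text \<open>The first order of integration serves to apply a statement about the circle with the
  other coordinates fixed, the second to apply an induction hypothesis with the last coordinate
  fixed.\<close>

lemma torus_integral_Suc:
  fixes \<Phi> :: "complex \<Rightarrow> real"
  assumes \<Phi>: "continuous_on UNIV \<Phi>" and F: "F \<in> polyfun (Suc n)"
  shows "(\<integral>z. \<Phi> (F z) \<partial>torus_measure (Suc n))
      = (\<integral>z. (\<integral>w. \<Phi> (F (z(n := w))) \<partial>circle_measure) \<partial>torus_measure n)" (is ?fst)
    and "(\<integral>z. \<Phi> (F z) \<partial>torus_measure (Suc n))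
      = (\<integral>w. (\<integral>z. \<Phi> (F (z(n := w))) \<partial>torus_measure n) \<partial>circle_measure)" (is ?snd)
proof -
  show *: ?fst
    using torus.product_integral_insert[of "{..<n}" n "\<lambda>z. \<Phi> (F z)"] integrable_torus[OF \<Phi> F]
    by (simp add: torus_measure_def lessThan_Suc)
  interpret T: prob_space "torus_measure n" by (rule prob_space_torus_measure)
  interpret pair_prob_space "torus_measure n" circle_measure ..
  obtain B where B: "\<And>z. (\<And>i. i < Suc n \<Longrightarrow> norm (z i) \<le> 1) \<Longrightarrow> norm (\<Phi> (F z)) \<le> B"
    using polyfun_compose_bounded[OF \<Phi> F] by blast
  have "integrable (torus_measure n \<Otimes>\<^sub>M circle_measure) (\<lambda>(z, w). \<Phi> (F (z(n := w))))"
  proof (rule P.integrable_const_bound[of _ B])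
    show "(\<lambda>(z, w). \<Phi> (F (z(n := w)))) \<in> borel_measurable (torus_measure n \<Otimes>\<^sub>M circle_measure)"
      using measurable_compose[OF measurable_torus_update
          continuous_compose_measurable[OF \<Phi> measurable_torus_polyfun[OF F]]]
      by (simp add: case_prod_unfold)
    show "AE x in torus_measure n \<Otimes>\<^sub>M circle_measure.
        norm (case x of (z, w) \<Rightarrow> \<Phi> (F (z(n := w)))) \<le> B"
      by (intro AE_I2) (auto simp: space_pair_measure norm_torus less_Suc_eq intro!: B simp del: real_norm_def)
  qed
  from Fubini_integral[OF this] show ?snd
    using * by simp
qed

lemma torus_integral_0: "F \<in> polyfun 0 \<Longrightarrow> (\<integral>z. \<Phi> (F z) \<partial>torus_measure 0) = (\<Phi> (F z0) :: real)"
proof -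
  assume F: "F \<in> polyfun 0"
  interpret prob_space "torus_measure 0" by (rule prob_space_torus_measure)
  have "(\<integral>z. \<Phi> (F z) \<partial>torus_measure 0) = (\<integral>z. \<Phi> (F z0) \<partial>torus_measure 0)"
    using polyfun_cong[OF F] by (intro Bochner_Integration.integral_cong arg_cong[where f=\<Phi>]) auto
  then show ?thesis by (simp add: prob_space)
qed

lemma torus_integral_rotate:
  fixes \<Phi> :: "complex \<Rightarrow> real"
  assumes \<Phi>: "continuous_on UNIV \<Phi>" and w: "norm w = 1"
  shows "F \<in> polyfun n \<Longrightarrow>
    (\<integral>z. \<Phi> (F (\<lambda>i. w * z i)) \<partial>torus_measure n) = (\<integral>z. \<Phi> (F z) \<partial>torus_measure n)"
proof (induction n arbitrary: F)
  case 0
  then show ?case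
    using torus_integral_0[OF 0, of \<Phi> undefined] torus_integral_0[OF polyfun_scale[OF 0, of w], of \<Phi> undefined]
      polyfun_cong[OF 0, of undefined "\<lambda>i. w * undefined i"] by simp
next
  case (Suc n)
  have upd: "(\<lambda>i. w * (z(n := u)) i) = (\<lambda>i. w * z i)(n := w * u)" for z u
    by auto
  have slice: "continuous_on (sphere 0 1) (\<lambda>u. \<Phi> (F (z(n := u))))" for z
  proof -
    obtain P where "\<And>u. F (z(n := u)) = poly P u"
      using polyfun_slice[OF Suc.prems] by blast
    then show ?thesis
      by (simp add: continuous_on_compose2[OF \<Phi>] continuous_intros)
  qed
  have F': "(\<lambda>z. F ((\<lambda>i. w * z i)(n := u))) \<in> polyfun n" for u
    using polyfun_scale[OF polyfun_update[OF Suc.prems]] .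
  define Fw where "Fw z = F (\<lambda>i. if i < n then w * z i else z i)" for z
  have Fw_upd: "Fw (z(n := u)) = F ((\<lambda>i. w * z i)(n := u))" for z u
    unfolding Fw_def by (rule polyfun_cong[OF Suc.prems]) auto
  have Fw: "Fw \<in> polyfun (Suc n)"
    unfolding Fw_def[abs_def] by (rule polyfun_scale_below[OF Suc.prems])
  have "(\<integral>z. \<Phi> (F (\<lambda>i. w * z i)) \<partial>torus_measure (Suc n))
      = (\<integral>z. (\<integral>u. \<Phi> (F ((\<lambda>i. w * z i)(n := w * u))) \<partial>circle_measure) \<partial>torus_measure n)"
    by (subst torus_integral_Suc(1)[OF \<Phi> polyfun_scale[OF Suc.prems]]) (simp only: upd)
  also have "\<dots> = (\<integral>z. (\<integral>u. \<Phi> (F ((\<lambda>i. w * z i)(n := u))) \<partial>circle_measure) \<partial>torus_measure n)"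
    by (intro Bochner_Integration.integral_cong refl circle_integral_rotate[OF slice w])
  also have "\<dots> = (\<integral>z. \<Phi> (Fw z) \<partial>torus_measure (Suc n))"
    by (subst torus_integral_Suc(1)[OF \<Phi> Fw]) (simp only: Fw_upd)
  also have "\<dots> = (\<integral>u. (\<integral>z. \<Phi> (F ((\<lambda>i. w * z i)(n := u))) \<partial>torus_measure n) \<partial>circle_measure)"
    by (subst torus_integral_Suc(2)[OF \<Phi> Fw]) (simp only: Fw_upd)
  also have "\<dots> = (\<integral>u. (\<integral>z. \<Phi> (F (z(n := u))) \<partial>torus_measure n) \<partial>circle_measure)"
    by (intro Bochner_Integration.integral_cong refl Suc.IH[OF polyfun_update[OF Suc.prems]])
  also have "\<dots> = (\<integral>z. \<Phi> (F z) \<partial>torus_measure (Suc n))"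
    by (rule torus_integral_Suc(2)[OF \<Phi> Suc.prems, symmetric])
  finally show ?case .
qed

lemma continuous_norm_powr: "0 < s \<Longrightarrow> continuous_on UNIV (\<lambda>x::complex. norm x powr s)"
  by (intro continuous_on_powr' continuous_intros) auto

text \<open>Tensorization: the last coordinate is contracted with the others fixed, Minkowski's
  inequality with exponent \<open>q / p \<ge> 1\<close> exchanges the order of the norms, and the
  induction hypothesis contracts the other coordinates.\<close>

lemma hypercontractive_torus:
  assumes pq: "0 < p" "p \<le> q"
  defines "r \<equiv> complex_of_real (sqrt (p / q))"
  shows "F \<in> polyfun n \<Longrightarrow> (\<integral>z. norm (F (\<lambda>i. r * z i)) powr q \<partial>torus_measure n)
    \<le> (\<integral>z. norm (F z) powr p \<partial>torus_measure n) powr (q / p)"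
proof (induction n arbitrary: F)
  case 0
  have "F (\<lambda>i. r * undefined i) = F undefined"
    by (rule polyfun_cong[OF 0]) auto
  then show ?case
    using torus_integral_0[OF 0, of "\<lambda>x. norm x powr p" undefined]
      torus_integral_0[OF polyfun_scale[OF 0, of r], of "\<lambda>x. norm x powr q" undefined] pq
    by (simp add: powr_powr)
next
  case (Suc n)
  have q: "q > 0" using pq by simp
  note cp = continuous_norm_powr[OF pq(1)] and cq = continuous_norm_powr[OF q]
  have upd: "(\<lambda>i. r * (z(n := u)) i) = (\<lambda>i. r * z i)(n := r * u)" for z u
    by auto
  define Fr where "Fr z = F (\<lambda>i. if i < n then r * z i else z i)" for z
  have Fr_upd: "Fr (z(n := u)) = F ((\<lambda>i. r * z i)(n := u))" for z u
    unfolding Fr_def by (rule polyfun_cong[OF Suc.prems]) auto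
  have Fr: "Fr \<in> polyfun (Suc n)"
    unfolding Fr_def[abs_def] by (rule polyfun_scale_below[OF Suc.prems])
  define b where "b u = (\<integral>z. norm (F (z(n := u))) powr p \<partial>torus_measure n)" for u
  interpret T: prob_space "torus_measure n" by (rule prob_space_torus_measure)
  obtain B1 where B1: "\<And>z. (\<And>i. i < Suc n \<Longrightarrow> norm (z i) \<le> 1) \<Longrightarrow> norm (norm (F z) powr p) \<le> B1"
    using polyfun_compose_bounded[OF cp Suc.prems] by blast
  obtain B2 where B2: "\<And>z. (\<And>i. i < Suc n \<Longrightarrow> norm (z i) \<le> 1) \<Longrightarrow> norm (norm (Fr z) powr p) \<le> B2"
    using polyfun_compose_bounded[OF cp Fr] by blast
  have meas: "(\<lambda>(z, w). norm (G (z(n := w))) powr p) \<in> borel_measurable (torus_measure n \<Otimes>\<^sub>M circle_measure)"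
    if "G \<in> polyfun (Suc n)" for G
    using measurable_compose[OF measurable_torus_update
        continuous_compose_measurable[OF cp measurable_torus_polyfun[OF that]]]
    by (simp add: case_prod_unfold)
  have upd_le: "norm ((z(n := u)) i) \<le> 1"
    if "z \<in> space (torus_measure n)" "u \<in> space circle_measure" "i < Suc n" for z u i
    using that by (auto simp: norm_torus less_Suc_eq)
  have "(\<integral>z. norm (F (\<lambda>i. r * z i)) powr q \<partial>torus_measure (Suc n))
      = (\<integral>z. (\<integral>u. norm (F ((\<lambda>i. r * z i)(n := r * u))) powr q \<partial>circle_measure) \<partial>torus_measure n)"
    by (subst torus_integral_Suc(1)[OF cq polyfun_scale[OF Suc.prems]]) (simp only: upd)
  also have "\<dots> \<le> (\<integral>z. (\<integral>u. norm (Fr (z(n := u))) powr p \<partial>circle_measure) powr (q / p) \<partial>torus_measure n)"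
  proof (rule integral_mono)
    fix z
    obtain P where "\<And>u. F ((\<lambda>i. r * z i)(n := u)) = poly P u"
      using polyfun_slice[OF Suc.prems] by blast
    then show "(\<integral>u. norm (F ((\<lambda>i. r * z i)(n := r * u))) powr q \<partial>circle_measure)
        \<le> (\<integral>u. norm (Fr (z(n := u))) powr p \<partial>circle_measure) powr (q / p)"
      using hypercontractive_poly[OF pq, of P] by (simp add: Fr_upd r_def)
  next
    obtain B3 where B3: "\<And>z. (\<And>i. i < Suc n \<Longrightarrow> norm (z i) \<le> 1) \<Longrightarrow> norm (norm (F (\<lambda>i. r * z i)) powr q) \<le> B3"
      using polyfun_compose_bounded[OF cq polyfun_scale[OF Suc.prems]] by blast
    have m3: "(\<lambda>(z, u). norm (F ((\<lambda>i. r * z i)(n := r * u))) powr q)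
        \<in> borel_measurable (torus_measure n \<Otimes>\<^sub>M circle_measure)"
      using measurable_compose[OF measurable_torus_update
          continuous_compose_measurable[OF cq measurable_torus_polyfun[OF polyfun_scale[OF Suc.prems, of r]]]]
      by (simp only: case_prod_unfold upd)
    interpret pair_prob_space "torus_measure n" circle_measure ..
    have "integrable (torus_measure n \<Otimes>\<^sub>M circle_measure) (\<lambda>(z, u). norm (F ((\<lambda>i. r * z i)(n := r * u))) powr q)"
      by (rule P.integrable_const_bound[OF AE_I2 m3, of B3])
        (use B3 upd_le in \<open>auto simp: space_pair_measure upd[symmetric] simp del: real_norm_def\<close>)
    from integrable_fst'[OF this]
    show "integrable (torus_measure n)
        (\<lambda>z. \<integral>u. norm (F ((\<lambda>i. r * z i)(n := r * u))) powr q \<partial>circle_measure)"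
      by simp
    have bd: "0 \<le> (\<integral>u. norm (Fr (z(n := u))) powr p \<partial>circle_measure)
        \<and> (\<integral>u. norm (Fr (z(n := u))) powr p \<partial>circle_measure) \<le> B2"
      if z: "z \<in> space (torus_measure n)" for z
    proof -
      have "norm (Fr (z(n := u))) powr p \<le> B2" if "u \<in> space circle_measure" for u
        using B2[of "z(n := u)"] upd_le[OF z that] by simp
      moreover have "integrable circle_measure (\<lambda>u. norm (Fr (z(n := u))) powr p)"
      proof -
        obtain P where "\<And>u. Fr (z(n := u)) = poly P u"
          using polyfun_slice[OF Fr] by blast
        then show ?thesis
          by (simp add: integrable_circle_continuous continuous_on_compose2[OF cp] continuous_intros)
      qed
      ultimately have "(\<integral>u. norm (Fr (z(n := u))) powr p \<partial>circle_measure) \<le> (\<integral>u. B2 \<partial>circle_measure)"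
        by (intro integral_mono) auto
      then show ?thesis by simp
    qed
    have [measurable]: "(\<lambda>z. \<integral>u. norm (Fr (z(n := u))) powr p \<partial>circle_measure) \<in> borel_measurable (torus_measure n)"
      using meas[OF Fr] by (rule circle.borel_measurable_lebesgue_integral)
    show "integrable (torus_measure n)
        (\<lambda>z. (\<integral>u. norm (Fr (z(n := u))) powr p \<partial>circle_measure) powr (q / p))"
      by (rule T.integrable_const_bound[of _ "B2 powr (q / p)"])
        (use bd pq in \<open>auto intro!: AE_I2 powr_mono2\<close>)
  qed
  \<comment> \<open>Minkowski's inequality for the function \<open>norm (Fr _) powr p\<close>; the
    induction hypothesis at a frozen last coordinate \<open>u\<close> supplies the bound by
    \<open>b u\<close>.\<close>
  also have "\<dots> \<le> (\<integral>u. b u \<partial>circle_measure) powr (q / p)"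
  proof -
    have "(\<integral>z. (\<integral>u. (case (z, u) of (z, u) \<Rightarrow> norm (Fr (z(n := u))) powr p) \<partial>circle_measure) powr (q / p)
        \<partial>torus_measure n) \<le> (\<integral>u. b u \<partial>circle_measure) powr (q / p)"
    proof (rule minkowski_integral_le[where B="max B1 B2"])
      fix z u assume zu: "z \<in> space (torus_measure n)" "u \<in> space circle_measure"
      show "0 \<le> (case (z, u) of (z, u) \<Rightarrow> norm (Fr (z(n := u))) powr p)
          \<and> (case (z, u) of (z, u) \<Rightarrow> norm (Fr (z(n := u))) powr p) \<le> max B1 B2"
        using B2[of "z(n := u)"] upd_le[OF zu] by simp
    next
      fix u assume u: "u \<in> space circle_measure"
      have "b u \<le> (\<integral>z. B1 \<partial>torus_measure n)"
        unfolding b_def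
      proof (rule integral_mono)
        show "integrable (torus_measure n) (\<lambda>z. norm (F (z(n := u))) powr p)"
          by (rule integrable_torus[OF cp polyfun_update[OF Suc.prems]])
        show "norm (F (z(n := u))) powr p \<le> B1" if "z \<in> space (torus_measure n)" for z
          using B1[of "z(n := u)"] upd_le[OF that u] by simp
      qed simp
      then show "0 \<le> b u \<and> b u \<le> max B1 B2"
        by (auto simp: b_def T.prob_space)
      have "(\<integral>z. norm (F ((\<lambda>i. r * z i)(n := u))) powr q \<partial>torus_measure n) \<le> b u powr (q / p)"
        unfolding b_def by (rule Suc.IH[OF polyfun_update[OF Suc.prems]])
      then show "(\<integral>z. (case (z, u) of (z, u) \<Rightarrow> norm (Fr (z(n := u))) powr p) powr (q / p) \<partial>torus_measure n)
          \<le> b u powr (q / p)"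
        using pq by (simp add: Fr_upd powr_powr)
    next
      show "b \<in> borel_measurable circle_measure"
        unfolding b_def
        by (rule T.borel_measurable_lebesgue_integral)
          (use measurable_compose[OF measurable_pair_swap' meas[OF Suc.prems]]
            in \<open>simp only: case_prod_unfold fst_conv snd_conv\<close>)
    next
      show "(\<lambda>(z, u). norm (Fr (z(n := u))) powr p) \<in> borel_measurable (torus_measure n \<Otimes>\<^sub>M circle_measure)"
        by (rule meas[OF Fr])
    qed (use pq prob_space_torus_measure prob_space_circle_measure in auto)
    then show ?thesis by simp
  qed
  also have "(\<integral>u. b u \<partial>circle_measure) = (\<integral>z. norm (F z) powr p \<partial>torus_measure (Suc n))"
    unfolding b_def by (rule torus_integral_Suc(2)[OF cp Suc.prems, symmetric])
  finally show ?case .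
qed

section \<open>From polynomial functions to coefficient families: homogenization\<close>

lemma monomial_eval_polyfun:
  "Poly_Mapping.keys \<alpha> \<subseteq> {..<n} \<Longrightarrow> monomial_eval \<alpha> \<in> polyfun n"
  unfolding monomial_eval_def by (intro polyfun_prod polyfun_power polyfun_coord) auto

lemma poly_eval_polyfun: "P \<in> polys n \<Longrightarrow> poly_eval P \<in> polyfun n"
  unfolding poly_eval_def polys_def
  by (intro polyfun_sum polyfun_mult polyfun_const monomial_eval_polyfun) auto

lemma monomial_eval_scale: "monomial_eval \<alpha> (\<lambda>i. c * z i) = c ^ mdeg \<alpha> * monomial_eval \<alpha> z"
  by (simp add: monomial_eval_def mdeg_def power_mult_distrib prod.distrib power_sum)

lemma mdeg_le_total_deg: "\<alpha> \<in> Poly_Mapping.keys P \<Longrightarrow> mdeg \<alpha> \<le> total_deg P"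
  by (simp add: total_deg_def)

text \<open>Homogenizing with one additional variable does not change the norms, since by rotation
  invariance \<open>P(z / w)\<close> has the same distribution as \<open>P(z)\<close>.\<close>
lemma Lp_norm_le:
  assumes pq: "0 < p" "p \<le> q" and P: "P \<in> polys n"
  shows "Lp_norm q n P \<le> sqrt (q / p) ^ total_deg P * Lp_norm p n P"
proof -
  have q: "q > 0" using pq by simp
  define m where "m = total_deg P"
  define r where "r = sqrt (p / q)"
  have r: "r > 0" "1 / r = sqrt (q / p)"
    using pq by (simp_all add: r_def real_sqrt_divide)
  \<comment> \<open>This is \<open>w ^ m * P (z / w)\<close> with coordinate \<open>n\<close> as
    \<open>w\<close>, written without division; on the circle \<open>1 / w\<close> is
    \<open>cnj w\<close>.\<close>
  define F where "F z = (\<Sum>\<alpha>\<in>Poly_Mapping.keys P.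
      Poly_Mapping.lookup P \<alpha> * (monomial_eval \<alpha> z * z n ^ (m - mdeg \<alpha>)))" for z
  have keys: "Poly_Mapping.keys \<alpha> \<subseteq> {..<n}" if "\<alpha> \<in> Poly_Mapping.keys P" for \<alpha>
    using P that by (auto simp: polys_def)
  have F: "F \<in> polyfun (Suc n)"
    unfolding F_def[abs_def] using keys
    by (intro polyfun_sum polyfun_mult polyfun_const polyfun_power polyfun_coord monomial_eval_polyfun) force+
  have F_scale: "F (\<lambda>i. c * z i) = c ^ m * F z" for c z
  proof -
    have "c ^ m = c ^ mdeg \<alpha> * c ^ (m - mdeg \<alpha>)" if "\<alpha> \<in> Poly_Mapping.keys P" for \<alpha>
      using mdeg_le_total_deg[OF that] by (simp add: m_def flip: power_add)
    then show ?thesis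
      unfolding F_def sum_distrib_left
      by (intro sum.cong refl) (simp add: monomial_eval_scale power_mult_distrib mult_ac)
  qed
  have F_upd: "F (z(n := w)) = w ^ m * poly_eval P (\<lambda>i. cnj w * z i)" if "norm w = 1" for z w
  proof -
    have "monomial_eval \<alpha> (z(n := w)) = monomial_eval \<alpha> z" if "\<alpha> \<in> Poly_Mapping.keys P" for \<alpha>
      unfolding monomial_eval_def using keys[OF that] by (intro prod.cong) auto
    moreover have "w ^ m * cnj w ^ mdeg \<alpha> = w ^ (m - mdeg \<alpha>)" if "\<alpha> \<in> Poly_Mapping.keys P" for \<alpha>
    proof -
      have "w ^ m * cnj w ^ mdeg \<alpha> = w ^ (m - mdeg \<alpha>) * (w * cnj w) ^ mdeg \<alpha>"
        using mdeg_le_total_deg[OF that] by (simp add: m_def power_mult_distrib flip: power_add mult.assoc)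
      then show ?thesis
        using \<open>norm w = 1\<close> by (simp add: complex_norm_square[symmetric])
    qed
    ultimately show ?thesis
      unfolding F_def poly_eval_def sum_distrib_left
      by (intro sum.cong refl) (simp add: monomial_eval_scale mult_ac)
  qed
  have int_F: "(\<integral>z. norm (F z) powr s \<partial>torus_measure (Suc n))
      = (\<integral>z. norm (poly_eval P z) powr s \<partial>torus_measure n)" if "s > 0" for s
  proof -
    note cs = continuous_norm_powr[OF that]
    have "(\<integral>z. norm (F z) powr s \<partial>torus_measure (Suc n))
        = (\<integral>w. (\<integral>z. norm (F (z(n := w))) powr s \<partial>torus_measure n) \<partial>circle_measure)"
      by (rule torus_integral_Suc(2)[OF cs F])
    also have "\<dots> = (\<integral>w. (\<integral>z. norm (poly_eval P z) powr s \<partial>torus_measure n) \<partial>circle_measure)"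
    proof (rule Bochner_Integration.integral_cong[OF refl])
      fix w assume "w \<in> space circle_measure"
      then have w: "norm w = 1" by simp
      have "(\<integral>z. norm (F (z(n := w))) powr s \<partial>torus_measure n)
          = (\<integral>z. norm (poly_eval P (\<lambda>i. cnj w * z i)) powr s \<partial>torus_measure n)"
        by (simp add: F_upd[OF w] norm_mult norm_power w)
      also have "\<dots> = (\<integral>z. norm (poly_eval P z) powr s \<partial>torus_measure n)"
        by (rule torus_integral_rotate[OF cs _ poly_eval_polyfun[OF P]]) (simp add: w)
      finally show "(\<integral>z. norm (F (z(n := w))) powr s \<partial>torus_measure n)
          = (\<integral>z. norm (poly_eval P z) powr s \<partial>torus_measure n)" .
    qed
    finally show ?thesis by simp
  qed
  define X where "X s = (\<integral>z. norm (poly_eval P z) powr s \<partial>torus_measure n)" for s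
  have X: "X s \<ge> 0" for s by (simp add: X_def)
  \<comment> \<open>The contraction multiplies \<open>F\<close> by \<open>r ^ m\<close>; moving this
    factor to the other side creates the constant \<open>(1 / r) ^ m\<close>.\<close>
  have "(\<integral>z. norm (F (\<lambda>i. complex_of_real r * z i)) powr q \<partial>torus_measure (Suc n))
      = (\<integral>z. (r ^ m) powr q * norm (F z) powr q \<partial>torus_measure (Suc n))"
    using r by (simp add: F_scale norm_mult norm_power powr_mult)
  also have "\<dots> = (r ^ m) powr q * X q"
    using int_F[OF q] by (simp add: X_def)
  finally have "(r ^ m) powr q * X q \<le> X p powr (q / p)"
    using hypercontractive_torus[OF pq F] int_F[OF pq(1)] by (simp add: r_def X_def)
  then have "((r ^ m) powr q * X q) powr (1 / q) \<le> (X p powr (q / p)) powr (1 / q)"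
    using X r q by (intro powr_mono2) auto
  then have "r ^ m * X q powr (1 / q) \<le> X p powr (1 / p)"
    using X r q by (simp add: powr_mult powr_powr)
  then have "(1 / r) ^ m * (r ^ m * X q powr (1 / q)) \<le> (1 / r) ^ m * X p powr (1 / p)"
    using r(1) by (intro mult_left_mono) auto
  moreover have "(1 / r) ^ m * (r ^ m * X q powr (1 / q)) = X q powr (1 / q)"
    using r(1) by (simp add: power_divide)
  ultimately have "X q powr (1 / q) \<le> (1 / r) ^ m * X p powr (1 / p)"
    by (simp only:)
  then show ?thesis
    by (simp add: Lp_norm_def X_def[symmetric] m_def r(2))
qed

section \<open>Sharpness\<close>

lemma mdeg_superset:
  "finite A \<Longrightarrow> Poly_Mapping.keys \<alpha> \<subseteq> A \<Longrightarrow> mdeg \<alpha> = (\<Sum>i\<in>A. Poly_Mapping.lookup \<alpha> i)"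
  unfolding mdeg_def by (rule sum.mono_neutral_left) (auto simp: in_keys_iff)

lemma monomial_eval_superset:
  "finite A \<Longrightarrow> Poly_Mapping.keys \<alpha> \<subseteq> A \<Longrightarrow> monomial_eval \<alpha> z = (\<Prod>i\<in>A. z i ^ Poly_Mapping.lookup \<alpha> i)"
  unfolding monomial_eval_def by (rule prod.mono_neutral_left) (auto simp: in_keys_iff)

lemma poly_eval_superset:
  "finite A \<Longrightarrow> Poly_Mapping.keys P \<subseteq> A \<Longrightarrow>
    poly_eval P z = (\<Sum>\<alpha>\<in>A. Poly_Mapping.lookup P \<alpha> * monomial_eval \<alpha> z)"
  unfolding poly_eval_def by (rule sum.mono_neutral_left) (auto simp: in_keys_iff)

lemma mdeg_add: "mdeg (\<alpha> + \<beta>) = mdeg \<alpha> + mdeg \<beta>"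
proof -
  define A where "A = Poly_Mapping.keys \<alpha> \<union> Poly_Mapping.keys \<beta>"
  have "Poly_Mapping.keys (\<alpha> + \<beta>) \<subseteq> A" unfolding A_def by (rule Poly_Mapping.keys_add)
  then show ?thesis
    using mdeg_superset[of A] by (simp add: A_def lookup_add sum.distrib)
qed

lemma monomial_eval_add: "monomial_eval (\<alpha> + \<beta>) z = monomial_eval \<alpha> z * monomial_eval \<beta> z"
proof -
  define A where "A = Poly_Mapping.keys \<alpha> \<union> Poly_Mapping.keys \<beta>"
  have "Poly_Mapping.keys (\<alpha> + \<beta>) \<subseteq> A" unfolding A_def by (rule Poly_Mapping.keys_add)
  then show ?thesis
    using monomial_eval_superset[of A] by (simp add: A_def lookup_add power_add prod.distrib)
qed

lemma poly_eval_add: "poly_eval (P + Q) z = poly_eval P z + poly_eval Q z"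
proof -
  define A where "A = Poly_Mapping.keys P \<union> Poly_Mapping.keys Q"
  have "Poly_Mapping.keys (P + Q) \<subseteq> A" unfolding A_def by (rule Poly_Mapping.keys_add)
  then show ?thesis
    using poly_eval_superset[of A] by (simp add: A_def lookup_add distrib_right sum.distrib)
qed

lemma poly_eval_0 [simp]: "poly_eval 0 z = 0"
  by (simp add: poly_eval_def)

lemma poly_eval_single: "poly_eval (Poly_Mapping.single \<alpha> c) z = c * monomial_eval \<alpha> z"
  using poly_eval_superset[of "{\<alpha>}" "Poly_Mapping.single \<alpha> c" z] by (simp add: keys_single)

lemma poly_eval_sum: "poly_eval (\<Sum>a\<in>A. f a) z = (\<Sum>a\<in>A. poly_eval (f a) z)"
  by (induction A rule: infinite_finite_induct) (auto simp: poly_eval_add)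

lemma cpoly_eq_sum_single:
  fixes P :: cpoly
  shows "P = (\<Sum>\<alpha>\<in>Poly_Mapping.keys P. Poly_Mapping.single \<alpha> (Poly_Mapping.lookup P \<alpha>))"
  by (rule poly_mapping_eqI)
     (auto simp: lookup_sum lookup_single when_def in_keys_iff)

lemma poly_eval_mult: "poly_eval (P * Q) z = poly_eval P z * poly_eval Q z"
proof -
  have "P * Q = (\<Sum>\<alpha>\<in>Poly_Mapping.keys P. \<Sum>\<beta>\<in>Poly_Mapping.keys Q.
      Poly_Mapping.single (\<alpha> + \<beta>) (Poly_Mapping.lookup P \<alpha> * Poly_Mapping.lookup Q \<beta>))"
    by (subst cpoly_eq_sum_single[of P], subst cpoly_eq_sum_single[of Q])
       (simp add: sum_product mult_single)
  then have "poly_eval (P * Q) z = (\<Sum>\<alpha>\<in>Poly_Mapping.keys P. \<Sum>\<beta>\<in>Poly_Mapping.keys Q.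
      (Poly_Mapping.lookup P \<alpha> * monomial_eval \<alpha> z) * (Poly_Mapping.lookup Q \<beta> * monomial_eval \<beta> z))"
    by (simp add: poly_eval_sum poly_eval_single monomial_eval_add mult_ac)
  then show ?thesis by (simp add: poly_eval_def sum_product)
qed

definition linear_form :: "nat \<Rightarrow> cpoly" where
  "linear_form n = (\<Sum>i<n. Poly_Mapping.single (Poly_Mapping.single i 1) 1)"

lemma poly_eval_linear_form_power: "poly_eval (linear_form n ^ m) z = (\<Sum>i<n. z i) ^ m"
proof (induction m)
  case 0
  show ?case
    using poly_eval_single[of 0 1 z] by (simp add: monomial_eval_def)
next
  case (Suc m)
  have "poly_eval (linear_form n) z = (\<Sum>i<n. z i)"
    by (simp add: linear_form_def poly_eval_sum poly_eval_single monomial_eval_def)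
  then show ?case by (simp add: poly_eval_mult Suc)
qed

lemma keys_linear_form_power:
  "\<alpha> \<in> Poly_Mapping.keys (linear_form n ^ m) \<Longrightarrow> mdeg \<alpha> = m \<and> Poly_Mapping.keys \<alpha> \<subseteq> {..<n}"
proof (induction m arbitrary: \<alpha>)
  case 0
  then show ?case by (simp add: mdeg_def flip: single_one)
next
  case (Suc m)
  have "\<exists>\<beta> \<gamma>. \<alpha> = \<beta> + \<gamma> \<and> \<beta> \<in> Poly_Mapping.keys (linear_form n) \<and> \<gamma> \<in> Poly_Mapping.keys (linear_form n ^ m)"
    using Suc.prems keys_mult[of "linear_form n" "linear_form n ^ m"] by auto
  then obtain \<beta> \<gamma> where *: "\<alpha> = \<beta> + \<gamma>" "\<beta> \<in> Poly_Mapping.keys (linear_form n)"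
    "\<gamma> \<in> Poly_Mapping.keys (linear_form n ^ m)" by blast
  have "Poly_Mapping.keys (linear_form n)
      \<subseteq> (\<Union>i<n. Poly_Mapping.keys (Poly_Mapping.single (Poly_Mapping.single i (1::nat)) (1::complex)))"
    unfolding linear_form_def by (rule Poly_Mapping.keys_sum)
  with *(2) have "\<exists>i<n. \<beta> = Poly_Mapping.single i 1" by auto
  then obtain i where i: "i < n" "\<beta> = Poly_Mapping.single i 1"
    by blast
  have "Poly_Mapping.keys \<alpha> \<subseteq> Poly_Mapping.keys \<beta> \<union> Poly_Mapping.keys \<gamma>"
    unfolding *(1) by (rule Poly_Mapping.keys_add)
  then show ?case
    using Suc.IH[OF *(3)] i by (auto simp: *(1) mdeg_add) (simp add: mdeg_def)
qed

lemma linear_form_power: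
  assumes "n \<ge> 1"
  shows "linear_form n ^ m \<in> polys n" "total_deg (linear_form n ^ m) = m"
    "homogeneous (linear_form n ^ m)"
proof -
  show "linear_form n ^ m \<in> polys n"
    using keys_linear_form_power by (auto simp: polys_def)
  \<comment> \<open>The value is \<open>n ^ m\<close>. The zero polynomial must be excluded because
    its degree is 0 by convention.\<close>
  have "poly_eval (linear_form n ^ m) (\<lambda>_. 1) \<noteq> 0"
    using assms by (simp add: poly_eval_linear_form_power)
  then have "linear_form n ^ m \<noteq> 0" by force
  then have "Poly_Mapping.keys (linear_form n ^ m) \<noteq> {}" by simp
  then have "mdeg ` Poly_Mapping.keys (linear_form n ^ m) = {m}"
    using keys_linear_form_power by fastforce
  then show *: "total_deg (linear_form n ^ m) = m"
    by (simp add: total_deg_def)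
  have "Poly_Mapping.lookup (linear_form n ^ m) \<alpha> = 0" if "mdeg \<alpha> < m" for \<alpha>
    using that keys_linear_form_power[of \<alpha> n m] by (auto simp: in_keys_iff)
  then show "homogeneous (linear_form n ^ m)"
    unfolding homogeneous_def m_homogeneous_def using * by blast
qed

section \<open>Moments of a sum of independent uniform points of the circle\<close>

definition sum_moment :: "nat \<Rightarrow> real \<Rightarrow> real" where
  "sum_moment n s = (\<integral>z. norm (\<Sum>i<n. z i) powr s \<partial>torus_measure n)"

lemma Lp_norm_linear_form_power:
  assumes "m \<ge> 1"
  shows "Lp_norm s n (linear_form n ^ m) = sum_moment n (m * s) powr (1 / s)"
proof -
  have "(x ^ m) powr s = x powr (m * s)" if "x \<ge> 0" for x :: real
    using that assms by (simp add: powr_powr flip: powr_realpow')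
  then show ?thesis
    by (simp add: Lp_norm_def sum_moment_def poly_eval_linear_form_power norm_power)
qed

lemma polyfun_coordinate_sum: "n \<le> m \<Longrightarrow> (\<lambda>z. \<Sum>i<n. z i) \<in> polyfun m"
  by (intro polyfun_sum polyfun_coord) auto

text \<open>Parseval for \<open>(a + w) ^ k\<close> as a polynomial in \<open>w\<close>.\<close>

lemma circle_integral_norm_add_power:
  "(\<integral>w. norm (a + w) ^ (2 * k) \<partial>circle_measure) = (\<Sum>j\<le>k. (real (k choose j))\<^sup>2 * norm a ^ (2 * (k - j)))"
proof -
  define P where "P = [:a, 1:] ^ k"
  have deg: "degree P \<le> k" using degree_power_le[of "[:a, 1:]" k] by (simp add: P_def)
  have "norm (a + w) ^ (2 * k) = (norm (poly P w))\<^sup>2" for w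
    by (simp add: P_def poly_power norm_power mult.commute flip: power_mult)
  then have "complex_of_real (norm (a + w) ^ (2 * k)) = poly P w * cnj (poly P w)" for w
    by (simp only: complex_norm_square)
  then have "complex_of_real (\<integral>w. norm (a + w) ^ (2 * k) \<partial>circle_measure)
      = (\<integral>w. poly P w * cnj (poly P w) \<partial>circle_measure)"
    by (simp only: integral_complex_of_real[symmetric])
  also have "\<dots> = (\<Sum>j\<le>k. coeff P j * cnj (coeff P j))"
    by (rule circle_integral_poly_cnj[OF deg deg])
  also have "\<dots> = complex_of_real (\<Sum>j\<le>k. (real (k choose j))\<^sup>2 * norm a ^ (2 * (k - j)))"
    unfolding of_real_sum
  proof (intro sum.cong refl)
    fix j assume "j \<in> {..k}"
    then have "coeff P j = of_nat (k choose j) * a ^ (k - j)"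
      by (simp add: P_def coeff_linear_poly_power)
    then show "coeff P j * cnj (coeff P j) = complex_of_real ((real (k choose j))\<^sup>2 * norm a ^ (2 * (k - j)))"
      by (simp only: complex_norm_square[symmetric])
         (simp add: norm_mult norm_power power_mult_distrib mult.commute flip: power_mult)
  qed
  finally show ?thesis by (simp only: of_real_eq_iff)
qed

text \<open>\<open>0 powr 0 = 0\<close> but \<open>0 ^ 0 = 1\<close>. Hence
  \<open>even_moment\<close> is defined with natural powers: its recursion reaches the moment of
  order 0, which has to be 1.\<close>

lemma powr_even: "0 \<le> x \<Longrightarrow> x powr (2 * real k) = (if k = 0 \<and> x = 0 then 0 else x ^ (2 * k))"
  by (cases "x = 0") (auto simp flip: powr_realpow)

definition even_moment :: "nat \<Rightarrow> nat \<Rightarrow> real" where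
  "even_moment k n = (\<integral>z. norm (\<Sum>i<n. z i) ^ (2 * k) \<partial>torus_measure n)"

lemma even_moment_0: "even_moment k 0 = (if k = 0 then 1 else 0)"
  unfolding even_moment_def
  using prob_space.prob_space[OF prob_space_torus_measure[of 0]] by (simp add: power_0_left)

lemma even_moment_Suc:
  "even_moment k (Suc n) = (\<Sum>j\<le>k. (real (k choose j))\<^sup>2 * even_moment (k - j) n)"
proof -
  have c: "continuous_on UNIV (\<lambda>x::complex. norm x ^ l)" for l
    by (intro continuous_intros)
  have "even_moment k (Suc n)
      = (\<integral>z. (\<integral>w. norm (\<Sum>i<Suc n. (z(n := w)) i) ^ (2 * k) \<partial>circle_measure) \<partial>torus_measure n)"
    unfolding even_moment_def by (rule torus_integral_Suc(1)[OF c polyfun_coordinate_sum]) simp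
  also have "\<dots> = (\<integral>z. (\<Sum>j\<le>k. (real (k choose j))\<^sup>2 * norm (\<Sum>i<n. z i) ^ (2 * (k - j))) \<partial>torus_measure n)"
  proof -
    have "(\<Sum>i<Suc n. (z(n := w)) i) = (\<Sum>i<n. z i) + w" for z :: "nat \<Rightarrow> complex" and w
      by simp
    then show ?thesis by (simp only: circle_integral_norm_add_power)
  qed
  also have "\<dots> = (\<Sum>j\<le>k. (real (k choose j))\<^sup>2 * even_moment (k - j) n)"
    unfolding even_moment_def
    by (subst Bochner_Integration.integral_sum)
       (auto intro!: integrable_mult_right integrable_torus[OF c polyfun_coordinate_sum])
  finally show ?thesis .
qed

text \<open>The bound is the moment of a complex Gaussian of the same variance. In the recursion one
  factor \<open>k choose j\<close> is absorbed by the factorial, and the other completes the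
  binomial expansion of \<open>(1 + n) ^ k\<close>.\<close>

lemma even_moment_le: "even_moment k n \<le> fact k * real n ^ k"
proof (induction n arbitrary: k)
  case 0
  then show ?case by (simp add: even_moment_0)
next
  case (Suc n)
  have "even_moment k (Suc n) \<le> (\<Sum>j\<le>k. (real (k choose j))\<^sup>2 * (fact (k - j) * real n ^ (k - j)))"
    unfolding even_moment_Suc by (intro sum_mono mult_left_mono Suc.IH) auto
  also have "\<dots> \<le> (\<Sum>j\<le>k. fact k * (real (k choose j) * real n ^ (k - j)))"
  proof (rule sum_mono)
    fix j assume j: "j \<in> {..k}"
    have "fact j * fact (k - j) * (k choose j) = fact k"
      using j by (intro binomial_fact_lemma) simp
    then have "(k choose j) * fact (k - j) \<le> fact k"
      by (metis fact_ge_1 mult.assoc mult.commute mult_le_mono1 mult_1)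
    then have "real (k choose j) * fact (k - j) \<le> fact k"
      by (metis of_nat_fact of_nat_le_iff of_nat_mult)
    then have "(real (k choose j) * fact (k - j)) * (real (k choose j) * real n ^ (k - j))
        \<le> fact k * (real (k choose j) * real n ^ (k - j))"
      by (intro mult_right_mono) auto
    then show "(real (k choose j))\<^sup>2 * (fact (k - j) * real n ^ (k - j))
        \<le> fact k * (real (k choose j) * real n ^ (k - j))"
      by (simp add: power2_eq_square mult_ac)
  qed
  also have "\<dots> = fact k * (1 + real n) ^ k"
    by (simp add: binomial_ring sum_distrib_left)
  finally show ?case by (simp add: add.commute)
qed

text \<open>The moment is the sum of the squares of the multinomial coefficients of order
  \<open>k\<close>; the \<open>n choose k\<close> square-free ones equal \<open>fact k\<close>. In
  the recursion this means keeping the terms \<open>j = 0\<close> and \<open>j = 1\<close> and using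
  Pascal's rule.\<close>

lemma even_moment_ge: "(fact k)\<^sup>2 * real (n choose k) \<le> even_moment k n"
proof (induction n arbitrary: k)
  case 0
  then show ?case by (cases k) (auto simp: even_moment_0)
next
  case (Suc n)
  have nn: "0 \<le> even_moment k n" for k by (simp add: even_moment_def)
  show ?case
  proof (cases k)
    case 0
    have "even_moment 0 n \<le> even_moment 0 (Suc n)"
      by (simp add: even_moment_Suc)
    then show ?thesis using Suc.IH[of 0] 0 by simp
  next
    case (Suc l)
    have f: "(fact k :: real) = real k * fact l" by (simp add: Suc)
    have c: "real (Suc n choose k) = real (n choose k) + real (n choose l)" by (simp add: Suc)
    have "(fact k)\<^sup>2 * real (Suc n choose k)
        = (fact k)\<^sup>2 * real (n choose k) + (real k)\<^sup>2 * ((fact l)\<^sup>2 * real (n choose l))"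
      unfolding c f by (simp add: power_mult_distrib distrib_left)
    also have "\<dots> \<le> even_moment k n + (real k)\<^sup>2 * even_moment l n"
      by (intro add_mono mult_left_mono \<open>\<And>k. (fact k)\<^sup>2 * real (n choose k) \<le> even_moment k n\<close>) auto
    also have "\<dots> = (\<Sum>j\<in>{0, 1}. (real (k choose j))\<^sup>2 * even_moment (k - j) n)"
      by (simp add: Suc)
    also have "\<dots> \<le> even_moment k (Suc n)"
      unfolding even_moment_Suc using nn by (intro sum_mono2) (auto simp: Suc)
    finally show ?thesis .
  qed
qed

text \<open>Jensen's inequality: the tangent is taken at the mean, so that its linear term
  integrates to 0.\<close>

lemma (in prob_space) integral_powr_ge:
  fixes g :: "'a \<Rightarrow> real"
  assumes "integrable M g" "integrable M (\<lambda>x. g x powr a)" "\<And>x. 0 \<le> g x" "a \<ge> 1"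
  shows "(\<integral>x. g x \<partial>M) powr a \<le> (\<integral>x. g x powr a \<partial>M)"
proof (cases "(\<integral>x. g x \<partial>M) = 0")
  case True
  then show ?thesis by simp
next
  case False
  define c where "c = (\<integral>x. g x \<partial>M)"
  have "c > 0"
    using False Bochner_Integration.integral_nonneg[of M g] assms(3) by (simp add: c_def less_le)
  have "c powr a = (\<integral>x. c powr a + a * c powr (a - 1) * (g x - c) \<partial>M)"
    using assms(1) by (simp add: c_def prob_space)
  also have "\<dots> \<le> (\<integral>x. g x powr a \<partial>M)"
    using assms \<open>c > 0\<close> by (intro integral_mono powr_tangent_le) auto
  finally show ?thesis by (simp add: c_def)
qed

text \<open>This permits rounding the exponents \<open>m * q\<close> and \<open>m * p\<close> to
  even integers, where the moments satisfy explicit bounds.\<close>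

lemma sum_moment_mono:
  assumes "0 < s" "s \<le> t"
  shows "sum_moment n s powr (1 / s) \<le> sum_moment n t powr (1 / t)"
proof -
  interpret prob_space "torus_measure n" by (rule prob_space_torus_measure)
  have int: "integrable (torus_measure n) (\<lambda>z. norm (\<Sum>i<n. z i) powr u)" if "u > 0" for u
    using that by (intro integrable_torus[OF continuous_norm_powr polyfun_coordinate_sum]) auto
  have eq: "(\<lambda>z. (norm (\<Sum>i<n. z i) powr s) powr (t / s)) = (\<lambda>z. norm (\<Sum>i<n. z i) powr t)"
    using assms by (simp add: powr_powr)
  have "(\<integral>z. norm (\<Sum>i<n. z i) powr s \<partial>torus_measure n) powr (t / s)
      \<le> (\<integral>z. (norm (\<Sum>i<n. z i) powr s) powr (t / s) \<partial>torus_measure n)"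
  proof (rule integral_powr_ge)
    show "integrable (torus_measure n) (\<lambda>z. norm (\<Sum>i<n. z i) powr s)"
      using assms by (intro int)
    show "integrable (torus_measure n) (\<lambda>z. (norm (\<Sum>i<n. z i) powr s) powr (t / s))"
      unfolding eq using assms by (intro int) simp
  qed (use assms in auto)
  then have "sum_moment n s powr (t / s) \<le> sum_moment n t"
    by (simp add: sum_moment_def eq)
  then have "(sum_moment n s powr (t / s)) powr (1 / t) \<le> sum_moment n t powr (1 / t)"
    using assms by (intro powr_mono2) auto
  then show ?thesis
    using assms by (simp add: powr_powr)
qed

lemma sum_moment_even: "k > 0 \<Longrightarrow> sum_moment n (2 * real k) = even_moment k n"
  by (simp add: sum_moment_def even_moment_def powr_even)

section \<open>Factorials and the lower bound for the constant\<close>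

lemma fact_ge_power: "(real k / exp 1) ^ k \<le> fact k"
proof (induction k)
  case (Suc k)
  show ?case
  proof (cases "k = 0")
    case True
    then show ?thesis by simp
  next
    case False
    \<comment> \<open>The induction step amounts to
      \<open>(1 + 1 / k) ^ k \<le> exp 1\<close>.\<close>
    have "((real k + 1) / k) ^ k \<le> exp (1 / k) ^ k"
      using exp_ge_add_one_self[of "1 / real k"] False by (intro power_mono) (auto simp: field_simps)
    also have "\<dots> = exp 1" using False by (simp flip: exp_of_nat_mult)
    finally have "(real k + 1) ^ k \<le> exp 1 * real k ^ k"
      using False by (simp add: power_divide field_simps)
    then have "(real k + 1) * (real k + 1) ^ k / exp 1 ^ Suc k
        \<le> (real k + 1) * (exp 1 * real k ^ k) / exp 1 ^ Suc k"
      by (intro divide_right_mono mult_left_mono) auto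
    then have "((real k + 1) / exp 1) ^ Suc k \<le> (real k + 1) * (exp 1 * real k ^ k) / exp 1 ^ Suc k"
      by (simp only: power_divide power_Suc times_divide_times_eq)
    also have "\<dots> = (real k + 1) * (real k / exp 1) ^ k"
      by (simp add: power_divide)
    also have "\<dots> \<le> (real k + 1) * fact k"
      by (intro mult_left_mono Suc.IH) auto
    finally show ?thesis by (simp add: add.commute)
  qed
qed simp

text \<open>The induction step amounts to \<open>(1 + 1 / k) ^ (k + 1) \<ge> exp 1\<close>. The
  extra factor \<open>exp 1 * k\<close> tends to 1 once the root of order \<open>2 * k\<close> is
  taken.\<close>

lemma fact_le_power: "k \<ge> 1 \<Longrightarrow> fact k \<le> exp 1 * real k * (real k / exp 1) ^ k"
proof (induction k rule: dec_induct)
  case (step k)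
  have "(real k / (real k + 1)) ^ Suc k \<le> exp (- 1 / (real k + 1)) ^ Suc k"
    using exp_ge_add_one_self[of "- 1 / (real k + 1)"] by (intro power_mono) (auto simp: field_simps)
  also have "real (Suc k) * (- 1 / (real k + 1)) = - 1" by (simp add: field_simps)
  then have "exp (- 1 / (real k + 1)) ^ Suc k = exp (- 1)" by (simp only: exp_of_nat_mult[symmetric])
  finally have "real k ^ Suc k \<le> exp (- 1) * (real k + 1) ^ Suc k"
    by (simp only: power_divide) (simp add: divide_le_eq)
  then have *: "exp 1 * (real k / exp 1) ^ Suc k \<le> ((real k + 1) / exp 1) ^ Suc k"
    by (simp add: power_divide exp_minus field_simps)
  have "fact (Suc k) \<le> (real k + 1) * (exp 1 * real k * (real k / exp 1) ^ k)"
    using step.IH by (simp add: add.commute mult_left_mono)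
  also have "\<dots> = exp 1 * (real k + 1) * (exp 1 * (real k / exp 1) ^ Suc k)"
    by simp
  also have "\<dots> \<le> exp 1 * (real k + 1) * ((real k + 1) / exp 1) ^ Suc k"
    by (intro mult_left_mono *) auto
  finally show ?case by (simp add: add.commute)
qed simp

lemma even_moment_ge_power:
  assumes "k \<le> n"
  shows "fact k * (real n - real k) ^ k \<le> even_moment k n"
proof -
  have "(real n - real k) ^ k = (\<Prod>i = 0..<k. real n - real k)" by simp
  also have "\<dots> \<le> (\<Prod>i = 0..<k. real n - real i)"
    using assms by (intro prod_mono) auto
  also have "\<dots> = fact k * real (n choose k)"
    by (simp add: binomial_gbinomial gbinomial_prod_rev)
  finally have "fact k * (real n - real k) ^ k \<le> fact k * (fact k * real (n choose k))"
    by (intro mult_left_mono) auto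
  then show ?thesis
    using even_moment_ge[of k n] unfolding power2_eq_square mult.assoc by linarith
qed

text \<open>Both roots of moments grow like \<open>sqrt n\<close>; after division by it, letting
  \<open>n\<close> tend to infinity leaves the Gaussian moments.\<close>

lemma fact_root_ratio_le:
  assumes a: "a \<ge> 1" and b: "b \<ge> 1"
    and le: "\<And>n. n \<ge> 1 \<Longrightarrow>
      even_moment a n powr (1 / (2 * real a)) \<le> C * even_moment b n powr (1 / (2 * real b))"
    and C: "C \<ge> 0"
  shows "fact a powr (1 / (2 * real a)) \<le> C * fact b powr (1 / (2 * real b))"
proof -
  have n_root: "(real n ^ k) powr (1 / (2 * real k)) = sqrt (real n)" if "k \<ge> 1" for k n
    using that by (simp add: powr_powr powr_half_sqrt flip: powr_realpow')
  have "(fact a * ((real n - real a) / real n) ^ a) powr (1 / (2 * real a))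
      \<le> C * fact b powr (1 / (2 * real b))" if n: "n \<ge> a" for n
  proof -
    have n0: "n \<ge> 1" using n a by simp
    have "fact a * (real n - real a) ^ a = fact a * ((real n - real a) / real n) ^ a * real n ^ a"
      using n0 by (simp add: power_divide)
    then have "(fact a * (real n - real a) ^ a) powr (1 / (2 * real a))
        = (fact a * ((real n - real a) / real n) ^ a) powr (1 / (2 * real a)) * sqrt (real n)"
      using n by (simp only: powr_mult n_root[OF a])
    moreover have "(fact a * (real n - real a) ^ a) powr (1 / (2 * real a))
        \<le> even_moment a n powr (1 / (2 * real a))"
      using n by (intro powr_mono2 even_moment_ge_power) auto
    moreover have "even_moment b n powr (1 / (2 * real b)) \<le> (fact b * real n ^ b) powr (1 / (2 * real b))"
      by (intro powr_mono2 even_moment_le) (auto simp: even_moment_def)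
    then have "C * even_moment b n powr (1 / (2 * real b)) \<le> C * (fact b powr (1 / (2 * real b)) * sqrt (real n))"
      using C by (intro mult_left_mono) (simp_all add: powr_mult n_root[OF b])
    ultimately have "(fact a * ((real n - real a) / real n) ^ a) powr (1 / (2 * real a)) * sqrt (real n)
        \<le> C * fact b powr (1 / (2 * real b)) * sqrt (real n)"
      using le[OF n0] by (simp add: mult.assoc)
    then show ?thesis using n0 by simp
  qed
  moreover have "(\<lambda>n. (fact a * ((real n - real a) / real n) ^ a) powr (1 / (2 * real a)))
      \<longlonglongrightarrow> (fact a * 1 ^ a) powr (1 / (2 * real a))"
  proof (intro tendsto_powr tendsto_mult tendsto_power tendsto_const)
    show "(\<lambda>n. (real n - real a) / real n) \<longlonglongrightarrow> 1" by real_asymp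
  qed auto
  ultimately show ?thesis
    by (intro LIMSEQ_le_const2) auto
qed

text \<open>Two successive limits: for fixed \<open>m\<close>, large \<open>n\<close> replaces
  moments by factorials; then large \<open>m\<close> turns the ratio of the roots of these
  factorials into \<open>sqrt (q / p)\<close>.\<close>

lemma sqrt_ratio_le:
  assumes pq: "0 < p" "p < q" and C: "C \<ge> 0"
    and le: "\<And>n m. n \<ge> 1 \<Longrightarrow> m \<ge> 1 \<Longrightarrow>
      sum_moment n (real m * q) powr (1 / q) \<le> C ^ m * sum_moment n (real m * p) powr (1 / p)"
  shows "sqrt (q / p) \<le> C"
proof -
  \<comment> \<open>The \<open>L^q\<close> norm of an m-th power is the m-th power of the
    \<open>L^(m q)\<close> norm, so the m-th root of the hypothesis compares norms of the sum
    itself.\<close>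
  have even: "even_moment a n powr (1 / (2 * real a)) \<le> C * even_moment b n powr (1 / (2 * real b))"
    if "n \<ge> 1" "m \<ge> 1" "a \<ge> 1" "b \<ge> 1" "2 * real a \<le> m * q" "m * p \<le> 2 * real b" for n m a b :: nat
  proof -
    have "sum_moment n (2 * real a) powr (1 / (2 * real a)) \<le> sum_moment n (m * q) powr (1 / (m * q))"
      using that by (intro sum_moment_mono) auto
    also have "\<dots> = (sum_moment n (m * q) powr (1 / q)) powr (1 / m)"
      by (simp add: powr_powr mult.commute)
    also have "\<dots> \<le> (C ^ m * sum_moment n (m * p) powr (1 / p)) powr (1 / m)"
      using that by (intro powr_mono2 le) auto
    also have "\<dots> = C * sum_moment n (m * p) powr (1 / (m * p))"
    proof -
      have "(C ^ m) powr (1 / m) = C"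
        using that C by (simp add: powr_powr flip: powr_realpow')
      then show ?thesis by (simp add: powr_mult C powr_powr mult.commute)
    qed
    also have "\<dots> \<le> C * sum_moment n (2 * real b) powr (1 / (2 * real b))"
      using that pq C by (intro mult_left_mono sum_moment_mono) auto
    finally show ?thesis using that by (simp add: sum_moment_even)
  qed
  have ratio: "(real a / real b) powr (1 / 2) \<le> C * (exp 1 * real b) powr (1 / (2 * real b))"
    if "m \<ge> 1" "a \<ge> 1" "b \<ge> 1" "2 * real a \<le> m * q" "m * p \<le> 2 * real b" for m a b :: nat
  proof -
    have root: "(x ^ k) powr (1 / (2 * real k)) = x powr (1 / 2)" if "k \<ge> 1" "x \<ge> 0" for k and x :: real
      using that by (simp add: powr_powr flip: powr_realpow')
    have "(real a / exp 1) powr (1 / 2) = ((real a / exp 1) ^ a) powr (1 / (2 * real a))"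
      using root[of a "real a / exp 1"] that by simp
    also have "\<dots> \<le> fact a powr (1 / (2 * real a))"
      by (intro powr_mono2 fact_ge_power) auto
    also have "\<dots> \<le> C * fact b powr (1 / (2 * real b))"
      using that C by (intro fact_root_ratio_le even) auto
    also have "\<dots> \<le> C * (exp 1 * real b * (real b / exp 1) ^ b) powr (1 / (2 * real b))"
      using that C by (intro mult_left_mono powr_mono2 fact_le_power) auto
    also have "\<dots> = C * (exp 1 * real b) powr (1 / (2 * real b)) * (real b / exp 1) powr (1 / 2)"
      using root[of b "real b / exp 1"] that by (simp add: powr_mult mult.assoc)
    finally have "(real a / exp 1) powr (1 / 2)
        \<le> C * (exp 1 * real b) powr (1 / (2 * real b)) * (real b / exp 1) powr (1 / 2)" .
    moreover have "(real a / exp 1) powr (1 / 2) = (real a / real b) powr (1 / 2) * (real b / exp 1) powr (1 / 2)"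
      using that by (simp flip: powr_mult)
    ultimately show ?thesis
      using that by simp
  qed
  \<comment> \<open>Rounded in opposite directions, as monotonicity of the norms demands:
    \<open>2 * a m\<close> stays below \<open>m * q\<close> and \<open>2 * b m\<close> above
    \<open>m * p\<close>. The ratio of \<open>a m\<close> and \<open>b m\<close> still tends to
    \<open>q / p\<close>.\<close>
  define a where "a m = nat \<lfloor>real m * q / 2\<rfloor>" for m
  define b where "b m = nat \<lceil>real m * p / 2\<rceil>" for m
  have bounds: "real m * q / 2 - 1 \<le> real (a m)" "2 * real (a m) \<le> real m * q"
    "real (b m) \<le> real m * p / 2 + 1" "real m * p \<le> 2 * real (b m)" for m
  proof -
    have "0 \<le> real m * q / 2" "0 \<le> real m * p / 2" using pq by auto
    then show "real m * q / 2 - 1 \<le> real (a m)" "2 * real (a m) \<le> real m * q"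
      "real (b m) \<le> real m * p / 2 + 1" "real m * p \<le> 2 * real (b m)"
      unfolding a_def b_def by linarith+
  qed
  have b_top: "filterlim (\<lambda>m. real (b m)) at_top sequentially"
  proof (rule filterlim_at_top_mono)
    show "filterlim (\<lambda>m. real m * p / 2) at_top sequentially"
      using pq by real_asymp
    show "\<forall>\<^sub>F m in sequentially. real m * p / 2 \<le> real (b m)"
      using bounds(4) by (intro always_eventually allI) (simp add: field_simps)
  qed
  have "((\<lambda>x::real. (exp 1 * x) powr (1 / (2 * x))) \<longlongrightarrow> 1) at_top"
    by real_asymp
  from filterlim_compose[OF this b_top]
  have rhs: "(\<lambda>m. C * (exp 1 * real (b m)) powr (1 / (2 * real (b m)))) \<longlonglongrightarrow> C * 1"
    by (intro tendsto_mult tendsto_const)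
  have "(\<lambda>m. (real m * q / 2 - 1) / (real m * p / 2 + 1)) \<longlonglongrightarrow> q / p"
    using pq by real_asymp
  then have lhs: "(\<lambda>m. ((real m * q / 2 - 1) / (real m * p / 2 + 1)) powr (1 / 2)) \<longlonglongrightarrow> (q / p) powr (1 / 2)"
    using pq by (intro tendsto_powr tendsto_const) auto
  have "filterlim (\<lambda>m. real m * q / 2 - 1) at_top sequentially"
    using pq by real_asymp
  then have "\<forall>\<^sub>F m in sequentially. real m * q / 2 - 1 \<ge> 1"
    unfolding filterlim_at_top by blast
  then have "\<forall>\<^sub>F m in sequentially. ((real m * q / 2 - 1) / (real m * p / 2 + 1)) powr (1 / 2)
      \<le> C * (exp 1 * real (b m)) powr (1 / (2 * real (b m)))"
  proof eventually_elim
    case (elim m)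
    then have m: "m \<ge> 1" by (cases m) auto
    have am: "a m \<ge> 1" using bounds(1)[of m] elim by simp
    have "0 < real m * p" using m pq by simp
    then have bm: "b m \<ge> 1" using bounds(4)[of m] by (cases "b m") auto
    have "((real m * q / 2 - 1) / (real m * p / 2 + 1)) \<le> real (a m) / real (b m)"
      using elim bounds[of m] bm by (intro frac_le) auto
    moreover have "0 \<le> (real m * q / 2 - 1) / (real m * p / 2 + 1)"
      using elim pq by (intro divide_nonneg_nonneg) auto
    ultimately have "((real m * q / 2 - 1) / (real m * p / 2 + 1)) powr (1 / 2)
        \<le> (real (a m) / real (b m)) powr (1 / 2)"
      by (intro powr_mono2) auto
    also have "\<dots> \<le> C * (exp 1 * real (b m)) powr (1 / (2 * real (b m)))"
      using bounds by (intro ratio[OF m am bm]) auto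
    finally show ?case .
  qed
  from tendsto_le[OF _ rhs lhs this] show ?thesis
    using pq by (simp add: powr_half_sqrt)
qed

theorem theorem2p1:
  fixes p q :: real
  assumes "0 < p" and "p < q"
  shows "(\<exists>C::real. sqrt (q / p) \<le> C \<and> C \<le> sqrt (q / min p 2) \<and>
            (\<forall>n\<ge>1. \<forall>P\<in>polys n.
               Lp_norm q n P \<le> C ^ total_deg P * Lp_norm p n P))
       \<and> ((\<forall>n\<ge>1. \<forall>P\<in>polys n. homogeneous P \<longrightarrow>
               Lp_norm q n P \<le> sqrt (q / p) ^ total_deg P * Lp_norm p n P)
          \<and> (\<forall>C::real.
               (\<forall>n\<ge>1. \<forall>P\<in>polys n. homogeneous P \<longrightarrow>
                  Lp_norm q n P \<le> C ^ total_deg P * Lp_norm p n P)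
               \<longrightarrow> sqrt (q / p) \<le> C))"
\<comment> \<open>The lower end of the admissible interval is the witness: by homogenization it
  serves all polynomials.\<close>
proof (intro conjI exI[of _ "sqrt (q / p)"] allI impI ballI)
  show "sqrt (q / p) \<le> sqrt (q / min p 2)"
    using assms by (simp add: frac_le)
next
  fix n P assume "P \<in> polys n"
  then show "Lp_norm q n P \<le> sqrt (q / p) ^ total_deg P * Lp_norm p n P"
    using assms by (intro Lp_norm_le) auto
next
  fix n P assume "P \<in> polys n"
  then show "Lp_norm q n P \<le> sqrt (q / p) ^ total_deg P * Lp_norm p n P"
    using assms by (intro Lp_norm_le) auto
next
  fix C :: real
  assume C: "\<forall>n\<ge>1. \<forall>P\<in>polys n. homogeneous P \<longrightarrow>
    Lp_norm q n P \<le> C ^ total_deg P * Lp_norm p n P"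
  have le: "sum_moment n (real m * q) powr (1 / q) \<le> C ^ m * sum_moment n (real m * p) powr (1 / p)"
    if "n \<ge> 1" "m \<ge> 1" for n m
    using C[rule_format, OF that(1) linear_form_power(1,3)[OF that(1), of m]]
    by (simp add: Lp_norm_linear_form_power[OF that(2)] linear_form_power(2)[OF that(1)])
  \<comment> \<open>\<open>C\<close> is an arbitrary real number, but taking roots requires
    \<open>C \<ge> 0\<close>. The case \<open>n = m = 1\<close>, a single coordinate with all norms
    equal to 1, even yields \<open>C \<ge> 1\<close>.\<close>
  have "sum_moment 1 s = 1" for s
  proof -
    interpret prob_space "torus_measure 1" by (rule prob_space_torus_measure)
    have "sum_moment 1 s = (\<integral>z. 1 \<partial>torus_measure 1)"
      unfolding sum_moment_def by (intro Bochner_Integration.integral_cong) (auto simp: norm_torus)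
    then show ?thesis using prob_space by simp
  qed
  with le[of 1 1] have "C \<ge> 1" by simp
  then show "sqrt (q / p) \<le> C"
    using assms le by (intro sqrt_ratio_le) auto
qed (use assms in auto)

end
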